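(* Let $\delta>0$ and $\gamma\ge 0$, let $G$ be the inverse Gaussian subordinator with parameters $(\delta,\gamma)$, and let $H(t)=\inf\{u>0: G(u)>t\}$. Then for $t>0$ the density function $h(x,t)$ of $H(t)$ can be put in the integral form $$h(x,t) = \frac{\delta}{\pi}\, e^{\delta\gamma x -\frac{\gamma^2}{2}t}\int_{0}^{\infty}\frac{e^{-ty}}{y+\gamma^2/2}\left[\gamma \sin(\delta x\sqrt{2y}) + \sqrt{2y}\cos(\delta x\sqrt{2y})\right] dy, \qquad x>0.$$
   Context: Let $B$ be a standard Brownian motion. The inverse Gaussian (IG) subordinator with parameters $(\delta,\gamma)$ is $G(t)=\inf\{s>0: B(s)+\gamma s>\delta t\}$; it is a strictly increasing L\'evy process started at $0$ with $\mathbb{E}\,e^{-sG(x)}=e^{-\delta x(\sqrt{\gamma^2+2s}-\gamma)}$ for $s\ge 0$. Its first-exit time process is $H(t)=\inf\{u>0: G(u)>t\}$, $t\ge 0$, and $h(x,t)$ denotes the density in $x$ of the random variable $H(t)$. *)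

theory Defs
  imports "HOL-Probability.Probability"
begin

text \<open>Paths are continuous everywhere rather than almost surely, so that the first passage times
  below are measurable without assuming \<open>M\<close> complete.\<close>

locale standard_brownian_motion = prob_space M
  for M :: "'a measure" and B :: "real \<Rightarrow> 'a \<Rightarrow> real" +
  assumes measurable: "0 \<le> t \<Longrightarrow> B t \<in> borel_measurable M"
    and start: "AE \<omega> in M. B 0 \<omega> = 0"
    and indep_increments:
      "0 \<le> \<tau> 0 \<Longrightarrow> mono \<tau> \<Longrightarrow>
        indep_vars (\<lambda>_. borel) (\<lambda>i \<omega>. B (\<tau> (Suc i)) \<omega> - B (\<tau> i) \<omega>) {..<n::nat}"
    and gaussian_increments:
      "0 \<le> s \<Longrightarrow> s < t \<Longrightarrow>
        distributed M lborel (\<lambda>\<omega>. B t \<omega> - B s \<omega>) (\<lambda>x. ennreal (normal_density 0 (sqrt (t - s)) x))"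
    and continuous_paths: "\<omega> \<in> space M \<Longrightarrow> continuous_on {0..} (\<lambda>t. B t \<omega>)"

text \<open>The values lie in \<open>ereal\<close> so that the infimum is \<open>\<infinity>\<close> on the (null) set of paths
  that never exceed the level \<open>\<delta> t\<close>.\<close>

definition IG_subordinator ::
    "(real \<Rightarrow> 'a \<Rightarrow> real) \<Rightarrow> real \<Rightarrow> real \<Rightarrow> real \<Rightarrow> 'a \<Rightarrow> ereal" where
  "IG_subordinator B \<delta> \<gamma> t \<omega> = Inf {ereal s | s. 0 < s \<and> B s \<omega> + \<gamma> * s > \<delta> * t}"

text \<open>The infimum of reals is unproblematic for \<open>IG_subordinator\<close> with \<open>\<delta> > 0\<close>: a continuous path is
  bounded on \<open>[0, t + 1]\<close>, so the set is nonempty for every path.\<close>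

definition first_exit_time :: "(real \<Rightarrow> 'a \<Rightarrow> ereal) \<Rightarrow> real \<Rightarrow> 'a \<Rightarrow> real" where
  "first_exit_time G t \<omega> = Inf {u. 0 < u \<and> G u \<omega> > ereal t}"

end

theory Submission
  imports Defs
begin

text \<open>
  Write \<open>X\<^sub>s = B\<^sub>s + \<gamma> s\<close>. Pathwise, \<open>H(t) > x\<close> means that \<open>X\<close> exceeds the level \<open>\<delta> x\<close> somewhere on
  \<open>[0, t]\<close> (\<open>first_exit_time_greater_iff\<close>), so \<open>\<delta> H(t)\<close> is the running maximum of a Brownian motion
  with drift and the theorem is about the density of that maximum.

  The maximum is handled by a reflection principle that incorporates the drift
  (\<open>running_maximum_tail\<close>). Put \<open>g(y) = 1 + exp (- 2 \<gamma> y)\<close> for \<open>y > 0\<close> and \<open>g(y) = 0\<close> otherwise. Let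
  \<open>U(T, z)\<close> be the expectation of \<open>g(X\<^sub>T)\<close> for the process started from \<open>z\<close>. Reflecting the
  normal law gives \<open>U(T, 0) = 1\<close> for all \<open>T > 0\<close>. If \<open>X\<close> first exceeds \<open>a\<close> at a time
  \<open>\<tau> < t\<close>, then the conditional expectation of \<open>g(X\<^sub>t - a)\<close> given the past of \<open>\<tau>\<close> is
  \<open>U(t - \<tau>, 0) = 1\<close>; if \<open>X\<close> never exceeds \<open>a\<close>, then \<open>g(X\<^sub>t - a) = 0\<close>. Hence the maximum exceeds \<open>a\<close>
  with probability \<open>E g(X\<^sub>t - a) = U(t, - a)\<close>. The strong Markov property is replaced by its elementary
  version on the grid \<open>t k / n\<close>: there the first index above \<open>a\<close> satisfies an exact identity
  (\<open>grid_reflection\<close>) in which the overshoot is still present, and path continuity removes the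
  overshoot as \<open>n\<close> tends to infinity.

  Differentiating \<open>U(t, - a)\<close>, a combination of normal tails, gives the density
  \<open>max_density\<close> of the maximum. It equals
  \<open>exp (\<gamma> a - \<gamma>\<^sup>2 t / 2) (2 q(a) - 2 \<gamma> \<integral> exp (- \<gamma> z) q(a + z) dz)\<close>, with \<open>z\<close> ranging over the
  positive half line and \<open>q\<close> the density of \<open>N(0, t)\<close>. Writing \<open>q\<close> as the cosine transform of a Gaussian
  weight and exchanging the two integrals turns this into an integral over frequencies \<open>w > 0\<close>
  (\<open>frequency_integral\<close>), and \<open>y = w\<^sup>2 / 2\<close> gives the integral of the theorem.
\<close>

section \<open>The tail of the normal distribution\<close>

definition normal_tail :: "real \<Rightarrow> real" where
  "normal_tail x = (LBINT y:{x<..}. std_normal_density y)"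

lemma set_integrable_normal_density:
  "0 < \<sigma> \<Longrightarrow> A \<in> sets borel \<Longrightarrow> set_integrable lborel A (normal_density \<mu> \<sigma>)"
  unfolding set_integrable_def
  by (rule integrable_mult_indicator) auto

lemma DERIV_normal_tail: "(normal_tail has_real_derivative - std_normal_density x) (at x)"
proof -
  have cont: "continuous_on {x - 1..x + 1} std_normal_density"
    unfolding std_normal_density_def by (intro continuous_intros) auto
  have eq: "normal_tail u = normal_tail (x - 1) - integral {x - 1..u} std_normal_density"
    if u: "u \<in> {x - 1..x + 1}" for u
  proof -
    have "normal_tail (x - 1) = (LBINT y:{x - 1<..u} \<union> {u<..}. std_normal_density y)"
      unfolding normal_tail_def using u by (intro arg_cong[where f="\<lambda>S. set_lebesgue_integral lborel S _"]) auto
    also have "\<dots> = (LBINT y:{x - 1<..u}. std_normal_density y) + normal_tail u"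
      unfolding normal_tail_def
      by (rule set_integral_Un) (auto intro!: set_integrable_normal_density)
    also have "(LBINT y:{x - 1<..u}. std_normal_density y) = (LBINT y:{x - 1..u}. std_normal_density y)"
      unfolding set_lebesgue_integral_def
      by (rule integral_cong_AE)
        (auto intro!: eventually_mono[OF AE_lborel_singleton[of "x - 1"]] simp: indicator_def)
    also have "\<dots> = integral {x - 1..u} std_normal_density"
      by (rule set_borel_integral_eq_integral) (auto intro!: set_integrable_normal_density)
    finally show ?thesis by simp
  qed
  have "((\<lambda>u. normal_tail (x - 1) - integral {x - 1..u} std_normal_density)
      has_real_derivative - std_normal_density x) (at x within {x - 1..x + 1})"
    using DERIV_diff[OF DERIV_const integral_has_real_derivative[OF cont, of x]] by simp
  then have "((\<lambda>u. normal_tail (x - 1) - integral {x - 1..u} std_normal_density)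
      has_real_derivative - std_normal_density x) (at x)"
    by (simp add: at_within_Icc_at)
  then show ?thesis
    by (rule has_field_derivative_transform_within_open[where S="{x - 1<..<x + 1}"]) (simp, simp, rule eq[symmetric], simp)
qed

lemma continuous_on_normal_tail [continuous_intros]:
  "continuous_on A f \<Longrightarrow> continuous_on A (\<lambda>x. normal_tail (f x))"
  by (rule continuous_on_compose2[of UNIV normal_tail])
    (auto intro!: DERIV_continuous_on DERIV_subset[OF DERIV_normal_tail])

lemma normal_tail_minus: "normal_tail x + normal_tail (- x) = 1"
proof -
  have "normal_tail (- x) = (\<integral>y. indicator {- x<..} (0 + (-1) * y) * std_normal_density (0 + (-1) * y) \<partial>lborel)"
    unfolding normal_tail_def set_lebesgue_integral_def
    by (subst lborel_integral_real_affine[where c="-1" and t=0]) auto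
  also have "\<dots> = (LBINT y:{..<x}. std_normal_density y)"
    unfolding set_lebesgue_integral_def
    by (intro Bochner_Integration.integral_cong) (auto simp: indicator_def std_normal_density_def)
  finally have "normal_tail x + normal_tail (- x) =
      (LBINT y:{x<..} \<union> {..<x}. std_normal_density y)"
    unfolding normal_tail_def
    by (subst set_integral_Un) (auto intro!: set_integrable_normal_density)
  also have "\<dots> = (\<integral>y. std_normal_density y \<partial>lborel)"
    unfolding set_lebesgue_integral_def
    by (rule integral_cong_AE)
      (auto intro!: eventually_mono[OF AE_lborel_singleton[of x]] simp: indicator_def)
  finally show ?thesis by simp
qed

section \<open>The reflected payoff and its value function\<close>

text \<open>
  The weight \<open>exp (- 2 \<gamma> y)\<close> is the density that turns a Brownian motion with drift \<open>\<gamma>\<close> into one with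
  drift \<open>- \<gamma>\<close>. Adding it to \<open>1\<close> makes the payoff the one that reflection at level \<open>0\<close> produces for the
  drifted motion; for \<open>\<gamma> = 0\<close> it is the classical \<open>2\<close>.
\<close>
definition reflected_payoff :: "real \<Rightarrow> real \<Rightarrow> real" where
  "reflected_payoff \<gamma> y = (if 0 < y then 1 + exp (- 2 * \<gamma> * y) else 0)"

lemma reflected_payoff_measurable [measurable]: "reflected_payoff \<gamma> \<in> borel_measurable borel"
  unfolding reflected_payoff_def by measurable

lemma reflected_payoff_bounds:
  assumes "0 \<le> \<gamma>"
  shows "0 \<le> reflected_payoff \<gamma> y" "reflected_payoff \<gamma> y \<le> 2"
  using assms by (auto simp: reflected_payoff_def mult_nonneg_nonneg)

text \<open>
  This is the expected payoff, after time \<open>T\<close>, of a Brownian motion with drift \<open>\<gamma>\<close> started from \<open>z\<close>. Integrating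
  against the standard normal law rather than against \<open>N(0, T)\<close> includes the case \<open>T = 0\<close>, where the
  value is the payoff itself.
\<close>
definition reflected_value :: "real \<Rightarrow> real \<Rightarrow> real \<Rightarrow> real" where
  "reflected_value \<gamma> T z =
    (LINT x|std_normal_distribution. reflected_payoff \<gamma> (z + \<gamma> * T + sqrt T * x))"

lemma reflected_value_measurable [measurable]: "reflected_value \<gamma> T \<in> borel_measurable borel"
proof -
  interpret real_distribution std_normal_distribution by (rule real_dist_normal_dist)
  have "(\<lambda>z. reflected_value \<gamma> T z) \<in> borel_measurable borel"
    unfolding reflected_value_def by measurable
  then show ?thesis .
qed

lemma reflected_value_bounds:
  assumes "0 \<le> \<gamma>"
  shows "0 \<le> reflected_value \<gamma> T z" "reflected_value \<gamma> T z \<le> 2"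
proof -
  interpret real_distribution std_normal_distribution by (rule real_dist_normal_dist)
  show "0 \<le> reflected_value \<gamma> T z"
    unfolding reflected_value_def using assms
    by (intro integral_nonneg_AE) (auto simp: reflected_payoff_bounds)
  have "integrable std_normal_distribution (\<lambda>x. reflected_payoff \<gamma> (z + \<gamma> * T + sqrt T * x))"
    using assms
    by (intro integrable_const_bound[where B=2]) (auto simp: reflected_payoff_bounds)
  then show "reflected_value \<gamma> T z \<le> 2"
    unfolding reflected_value_def using assms
    by (intro integral_le_const) (auto simp: reflected_payoff_bounds)
qed

text \<open>
  Completing the square absorbs the factor \<open>exp (- 2 \<gamma> y)\<close> into a shift of the normal density by
  \<open>2 \<gamma> sqrt T\<close>, so both parts of the payoff contribute a normal tail.
\<close>
lemma reflected_value_eq: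
  assumes "0 < T"
  shows "reflected_value \<gamma> T z =
    normal_tail (- (z + \<gamma> * T) / sqrt T) + exp (- 2 * \<gamma> * z) * normal_tail (- (z - \<gamma> * T) / sqrt T)"
proof -
  define b where "b = - (z + \<gamma> * T) / sqrt T"
  define r where "r = sqrt T"
  have r: "0 < r" and T: "T = r * r" and sqrtT: "sqrt T = r" using assms by (auto simp: r_def)
  have br: "b * r = - (z + \<gamma> * T)" using r by (simp add: b_def sqrtT)
  have pos: "0 < z + \<gamma> * T + sqrt T * x \<longleftrightarrow> b < x" for x
  proof -
    have "b < x \<longleftrightarrow> b * r < x * r" using r by simp
    then show ?thesis unfolding br by (auto simp: sqrtT mult.commute)
  qed
  have shift: "std_normal_density x * exp (- 2 * \<gamma> * (z + \<gamma> * T + sqrt T * x)) =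
      exp (- 2 * \<gamma> * z) * std_normal_density (2 * \<gamma> * sqrt T + 1 * x)" for x
  proof -
    have "- x\<^sup>2 / 2 + (- 2 * \<gamma> * (z + \<gamma> * T + sqrt T * x)) =
        - 2 * \<gamma> * z + - (2 * \<gamma> * sqrt T + 1 * x)\<^sup>2 / 2"
      unfolding sqrtT T by (simp add: power2_eq_square algebra_simps)
    then have "exp (- x\<^sup>2 / 2) * exp (- 2 * \<gamma> * (z + \<gamma> * T + sqrt T * x)) =
        exp (- 2 * \<gamma> * z) * exp (- (2 * \<gamma> * sqrt T + 1 * x)\<^sup>2 / 2)"
      by (metis exp_add)
    then show ?thesis
      unfolding std_normal_density_def by (simp only: mult.assoc mult.left_commute[of "exp _" "1 / sqrt (2 * pi)"])
  qed
  have int1: "integrable lborel (\<lambda>x. indicator {b<..} x *\<^sub>R std_normal_density x)"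
    using set_integrable_normal_density[of 1 "{b<..}" 0] unfolding set_integrable_def by simp
  have "integrable lborel (\<lambda>x. std_normal_density (2 * \<gamma> * sqrt T + 1 * x))"
    by (rule lborel_integrable_real_affine) auto
  then have int2: "integrable lborel (\<lambda>x. indicator {b<..} x *\<^sub>R std_normal_density (2 * \<gamma> * sqrt T + 1 * x))"
    by (intro integrable_mult_indicator) auto
  have "normal_tail (- (z - \<gamma> * T) / sqrt T) =
      (\<integral>x. indicator {- (z - \<gamma> * T) / sqrt T<..} (2 * \<gamma> * sqrt T + 1 * x) *\<^sub>R
        std_normal_density (2 * \<gamma> * sqrt T + 1 * x) \<partial>lborel)"
    unfolding normal_tail_def set_lebesgue_integral_def
    by (subst lborel_integral_real_affine[where c=1 and t="2 * \<gamma> * sqrt T"]) auto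
  also have "\<dots> = (\<integral>x. indicator {b<..} x *\<^sub>R std_normal_density (2 * \<gamma> * sqrt T + 1 * x) \<partial>lborel)"
  proof -
    have "- (z - \<gamma> * T) / sqrt T < 2 * \<gamma> * sqrt T + 1 * x \<longleftrightarrow> b < x" for x
    proof -
      have "- (z - \<gamma> * T) / sqrt T = b + 2 * \<gamma> * r"
        unfolding b_def sqrtT T using r by (simp add: divide_simps algebra_simps)
      then show ?thesis by (simp add: sqrtT)
    qed
    then show ?thesis by (simp add: indicator_def)
  qed
  finally have tail: "(\<integral>x. indicator {b<..} x *\<^sub>R std_normal_density (2 * \<gamma> * sqrt T + 1 * x) \<partial>lborel) =
      normal_tail (- (z - \<gamma> * T) / sqrt T)" by simp
  have "reflected_value \<gamma> T z =
      (\<integral>x. std_normal_density x *\<^sub>R reflected_payoff \<gamma> (z + \<gamma> * T + sqrt T * x) \<partial>lborel)"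
    unfolding reflected_value_def by (rule integral_density) auto
  also have "\<dots> = (\<integral>x. indicator {b<..} x *\<^sub>R std_normal_density x +
      exp (- 2 * \<gamma> * z) * (indicator {b<..} x *\<^sub>R std_normal_density (2 * \<gamma> * sqrt T + 1 * x)) \<partial>lborel)"
  proof (intro Bochner_Integration.integral_cong refl)
    fix x :: real
    show "std_normal_density x *\<^sub>R reflected_payoff \<gamma> (z + \<gamma> * T + sqrt T * x) =
        indicator {b<..} x *\<^sub>R std_normal_density x + exp (- 2 * \<gamma> * z) *
          (indicator {b<..} x *\<^sub>R std_normal_density (2 * \<gamma> * sqrt T + 1 * x))"
    proof (cases "b < x")
      case True
      then have "indicator {b<..} x = (1 :: real)" by simp
      moreover have "p * (1 + q) = p + p * q" for p q :: real
        by (simp add: distrib_left)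
      ultimately show ?thesis
        by (simp only: reflected_payoff_def pos True if_True real_scaleR_def shift mult_1_left)
    qed (simp add: reflected_payoff_def pos)
  qed
  also have "\<dots> = normal_tail b + exp (- 2 * \<gamma> * z) * normal_tail (- (z - \<gamma> * T) / sqrt T)"
    using int1 int2 tail
    by (simp add: normal_tail_def set_lebesgue_integral_def)
  finally show ?thesis by (simp add: b_def)
qed

text \<open>
  At the barrier the two tails are complementary. This is why the payoff was chosen.
\<close>
lemma reflected_value_0:
  assumes "0 < T"
  shows "reflected_value \<gamma> T 0 = 1"
  using normal_tail_minus[of "\<gamma> * T / sqrt T"] assms by (simp add: reflected_value_eq)

text \<open>
  The value function is discontinuous at \<open>(0, 0)\<close>, so the remaining time has to stay away from \<open>0\<close>.
\<close>
lemma reflected_value_tendsto_1: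
  assumes T: "T \<longlonglongrightarrow> L" "0 < L" and z: "z \<longlonglongrightarrow> 0"
  shows "(\<lambda>n. reflected_value \<gamma> (T n) (z n)) \<longlonglongrightarrow> 1"
proof -
  define F where "F = (\<lambda>T z. normal_tail (- (z + \<gamma> * T) / sqrt T) +
    exp (- 2 * \<gamma> * z) * normal_tail (- (z - \<gamma> * T) / sqrt T))"
  have nt: "(\<lambda>n. normal_tail (u n)) \<longlonglongrightarrow> normal_tail l" if "u \<longlonglongrightarrow> l" for u l
    using isCont_tendsto_compose[OF DERIV_isCont[OF DERIV_normal_tail] that] .
  have "(\<lambda>n. F (T n) (z n)) \<longlonglongrightarrow> F L 0"
    unfolding F_def using T z by (intro tendsto_intros nt) auto
  also have "F L 0 = 1"
    using reflected_value_0[of L \<gamma>] reflected_value_eq[of L \<gamma> 0] T by (simp add: F_def)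
  finally show ?thesis
    by (rule Lim_transform_eventually)
      (use order_tendstoD(1)[OF T] in \<open>auto elim!: eventually_mono simp: F_def reflected_value_eq\<close>)
qed

section \<open>The density of the maximum\<close>

text \<open>
  For a Brownian motion with drift \<open>\<gamma>\<close> this is the density, at \<open>a \<ge> 0\<close>, of its maximum over \<open>[0, t]\<close>.
\<close>
definition max_density :: "real \<Rightarrow> real \<Rightarrow> real \<Rightarrow> real" where
  "max_density \<gamma> t a = 2 / sqrt t * std_normal_density ((a - \<gamma> * t) / sqrt t)
    - 2 * \<gamma> * exp (2 * \<gamma> * a) * normal_tail ((a + \<gamma> * t) / sqrt t)"

text \<open>
  An exponential tilt of the normal density is a shift (Cameron--Martin).
\<close>
lemma std_normal_density_tilt:
  assumes "0 < t"
  shows "exp (\<gamma> * a - \<gamma>\<^sup>2 * t / 2) * std_normal_density (a / sqrt t) = std_normal_density ((a - \<gamma> * t) / sqrt t)"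
proof -
  have "((a - \<gamma> * t) / sqrt t)\<^sup>2 = (a - \<gamma> * t)\<^sup>2 / t" "(a / sqrt t)\<^sup>2 = a\<^sup>2 / t"
    using assms by (simp_all add: power_divide)
  moreover have "(a - \<gamma> * t)\<^sup>2 / t = a\<^sup>2 / t - 2 * \<gamma> * a + \<gamma>\<^sup>2 * t"
    using assms by (simp add: field_simps power2_eq_square)
  ultimately have "- ((a - \<gamma> * t) / sqrt t)\<^sup>2 / 2 = (\<gamma> * a - \<gamma>\<^sup>2 * t / 2) + - (a / sqrt t)\<^sup>2 / 2"
    by simp
  then show ?thesis by (simp only: std_normal_density_def exp_add mult.left_commute)
qed

lemma DERIV_reflected_value_minus:
  assumes t: "0 < t"
  shows "((\<lambda>a. reflected_value \<gamma> t (- a)) has_real_derivative - max_density \<gamma> t a) (at a)"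
proof -
  let ?u = "(a - \<gamma> * t) / sqrt t" and ?v = "(a + \<gamma> * t) / sqrt t"
  have eq: "(\<lambda>a. reflected_value \<gamma> t (- a)) =
      (\<lambda>a. normal_tail ((a - \<gamma> * t) / sqrt t) + exp (2 * \<gamma> * a) * normal_tail ((a + \<gamma> * t) / sqrt t))"
    using t by (simp add: reflected_value_eq fun_eq_iff add.commute)
  have d: "((\<lambda>a. (a + c) / sqrt t) has_real_derivative 1 / sqrt t) (at a)" for c
    by (rule DERIV_cdivide) (auto intro!: derivative_eq_intros)
  have nt: "((\<lambda>a. normal_tail ((a + c) / sqrt t)) has_real_derivative
      - std_normal_density ((a + c) / sqrt t) * (1 / sqrt t)) (at a)" for c
    by (rule DERIV_chain2[OF DERIV_normal_tail d])
  have e: "((\<lambda>a. exp (2 * \<gamma> * a)) has_real_derivative 2 * \<gamma> * exp (2 * \<gamma> * a)) (at a)"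
    by (auto intro!: derivative_eq_intros)
  have "exp (2 * \<gamma> * a) * std_normal_density ?v = std_normal_density ?u"
  proof -
    have "std_normal_density ?v = exp (- \<gamma> * a - \<gamma>\<^sup>2 * t / 2) * std_normal_density (a / sqrt t)"
      using std_normal_density_tilt[OF t, of "- \<gamma>" a] by simp
    moreover have "exp (2 * \<gamma> * a) * exp (- \<gamma> * a - \<gamma>\<^sup>2 * t / 2) = exp (\<gamma> * a - \<gamma>\<^sup>2 * t / 2)"
      by (simp flip: exp_add)
    ultimately show ?thesis
      using std_normal_density_tilt[OF t, of \<gamma> a] by (metis mult.assoc)
  qed
  then have "- std_normal_density ?u * (1 / sqrt t) +
      (2 * \<gamma> * exp (2 * \<gamma> * a) * normal_tail ?v + - std_normal_density ?v * (1 / sqrt t) * exp (2 * \<gamma> * a))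
      = - max_density \<gamma> t a"
    by (simp add: max_density_def mult.commute[of "std_normal_density ?v"] mult.assoc)
  moreover have "((\<lambda>a. normal_tail ((a - \<gamma> * t) / sqrt t) + exp (2 * \<gamma> * a) * normal_tail ((a + \<gamma> * t) / sqrt t))
      has_real_derivative (- std_normal_density ?u * (1 / sqrt t) +
      (2 * \<gamma> * exp (2 * \<gamma> * a) * normal_tail ?v + - std_normal_density ?v * (1 / sqrt t) * exp (2 * \<gamma> * a)))) (at a)"
    using DERIV_add[OF nt[of "- (\<gamma> * t)"] DERIV_mult[OF e nt[of "\<gamma> * t"]]] by simp
  ultimately show ?thesis unfolding eq by simp
qed

section \<open>The density of the maximum as an integral over frequencies\<close>

lemma gaussian_weight_integrable:
  fixes t :: real
  assumes "0 < t"
  shows "integrable lborel (\<lambda>w. exp (- t * w\<^sup>2 / 2))"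
proof -
  have "integrable lborel (\<lambda>w. sqrt (2 * pi) * std_normal_density (0 + sqrt t * w))"
    using assms by (intro integrable_mult_right lborel_integrable_real_affine) auto
  moreover have "sqrt (2 * pi) * std_normal_density (0 + sqrt t * w) = exp (- t * w\<^sup>2 / 2)" for w
    using assms by (simp add: std_normal_density_def power_mult_distrib)
  ultimately show ?thesis by (simp only:)
qed

lemma integral_std_normal_cos:
  "(\<integral>x. std_normal_density x * cos (s * x) \<partial>lborel) = exp (- s\<^sup>2 / 2)"
proof -
  interpret N: real_distribution std_normal_distribution by (rule real_dist_normal_dist)
  have "exp (- s\<^sup>2 / 2) = Re (char std_normal_distribution s)"
    by (simp add: char_std_normal_distribution)
  also have "\<dots> = (LINT x|std_normal_distribution. Re (iexp (s * x)))"
    unfolding char_def by (rule integral_Re[symmetric]) (rule N.integrable_iexp, auto)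
  also have "\<dots> = (LINT x|std_normal_distribution. cos (s * x))"
    by (simp add: Re_exp)
  also have "\<dots> = (\<integral>x. std_normal_density x * cos (s * x) \<partial>lborel)"
    by (subst integral_density) auto
  finally show ?thesis by simp
qed

text \<open>
  The characteristic function of the normal law, rescaled; since the integrand is even, half of
  the integral over the line remains.
\<close>
lemma gaussian_cosine_transform:
  assumes t: "0 < t"
  shows "(LBINT w:{0<..}. exp (- t * w\<^sup>2 / 2) * cos (b * w)) = pi / sqrt t * std_normal_density (b / sqrt t)"
proof -
  let ?f = "\<lambda>w. exp (- t * w\<^sup>2 / 2) * cos (b * w)"
  have st: "0 < sqrt t" using t by simp
  have int: "integrable lborel ?f"
    by (rule Bochner_Integration.integrable_bound[OF gaussian_weight_integrable[OF t]]) (auto simp: abs_mult intro!: mult_left_le)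
  then have sint: "set_integrable lborel A ?f" if "A \<in> sets borel" for A
    unfolding set_integrable_def using that by (intro integrable_mult_indicator) auto
  have "exp (- (b / sqrt t)\<^sup>2 / 2) = (\<integral>x. std_normal_density x * cos (b / sqrt t * x) \<partial>lborel)"
    by (rule integral_std_normal_cos[symmetric])
  also have "\<dots> = sqrt t * (\<integral>w. std_normal_density (0 + sqrt t * w) * cos (b / sqrt t * (0 + sqrt t * w)) \<partial>lborel)"
    by (subst lborel_integral_real_affine[where c="sqrt t" and t=0]) (use st in auto)
  also have "\<dots> = sqrt t * (\<integral>w. ?f w / sqrt (2 * pi) \<partial>lborel)"
    using t by (simp add: std_normal_density_def power_mult_distrib)
  also have "\<dots> = sqrt t / sqrt (2 * pi) * (\<integral>w. ?f w \<partial>lborel)"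
    by simp
  also have "(\<integral>w. ?f w \<partial>lborel) = (LBINT w:{0<..} \<union> {..<0}. ?f w)"
    unfolding set_lebesgue_integral_def
    by (rule integral_cong_AE)
      (auto intro!: eventually_mono[OF AE_lborel_singleton[of 0]] simp: indicator_def)
  also have "\<dots> = (LBINT w:{0<..}. ?f w) + (LBINT w:{..<0}. ?f w)"
    by (rule set_integral_Un[OF _ sint sint]) auto
  also have "(LBINT w:{..<0}. ?f w) = (LBINT w:{0<..}. ?f w)"
    unfolding set_lebesgue_integral_def
    by (subst lborel_integral_real_affine[where c="-1" and t=0])
      (auto simp: indicator_def intro!: Bochner_Integration.integral_cong)
  finally have "(LBINT w:{0<..}. ?f w) = sqrt (2 * pi) / (2 * sqrt t) * exp (- (b / sqrt t)\<^sup>2 / 2)"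
    using st by (simp add: field_simps)
  also have "sqrt (2 * pi) / (2 * sqrt t) = pi / sqrt t * (1 / sqrt (2 * pi))"
  proof -
    have "sqrt (2 * pi) * sqrt (2 * pi) = 2 * pi" by simp
    then show ?thesis using st by (simp add: field_simps del: real_sqrt_mult_self)
  qed
  finally show ?thesis by (simp add: std_normal_density_def)
qed

lemma exp_decay_integrable:
  assumes "0 < \<gamma>"
  shows "set_integrable lborel {0<..} (\<lambda>z. exp (- \<gamma> * z :: real))"
proof -
  interpret prob_space "density lborel (exponential_density \<gamma>)"
    using assms by (rule prob_space_exponential_density)
  have "integrable (density lborel (exponential_density \<gamma>)) (\<lambda>_. 1 :: real)" by simp
  then have "integrable lborel (exponential_density \<gamma>)"
    by (subst (asm) integrable_density) (use assms in \<open>auto simp: exponential_density_nonneg\<close>)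
  then have "integrable lborel (\<lambda>z. exponential_density \<gamma> z / \<gamma>)" by simp
  then show ?thesis
    unfolding set_integrable_def
    by (rule integrable_cong_AE_imp)
      (use assms in \<open>auto intro!: eventually_mono[OF AE_lborel_singleton[of 0]] simp: exponential_density_def indicator_def\<close>)
qed

lemma exp_cos_half_line_integral:
  fixes a w \<gamma> :: real
  assumes \<gamma>: "0 < \<gamma>"
  shows "(LBINT z:{0<..}. exp (- \<gamma> * z) * cos ((a + z) * w)) = (\<gamma> * cos (a * w) - w * sin (a * w)) / (\<gamma>\<^sup>2 + w\<^sup>2)"
proof -
  \<comment> \<open>The real part of the antiderivative of \<open>exp (- \<gamma> z + \<i> (a + z) w)\<close>.\<close>
  define F where "F z = exp (- \<gamma> * z) * (w * sin ((a + z) * w) - \<gamma> * cos ((a + z) * w)) / (\<gamma>\<^sup>2 + w\<^sup>2)" for z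
  have pos: "0 < \<gamma>\<^sup>2 + w\<^sup>2" by (rule add_pos_nonneg) (use \<gamma> in auto)
  have int: "set_integrable lborel {0<..} (\<lambda>z. exp (- \<gamma> * z) * cos ((a + z) * w))"
    by (rule set_integrable_bound[OF exp_decay_integrable[OF \<gamma>]])
      (auto simp: set_borel_measurable_def abs_mult intro!: mult_left_le)
  have deriv: "(F has_real_derivative exp (- \<gamma> * z) * cos ((a + z) * w)) (at z)" for z
  proof -
    have "(F has_real_derivative
        (exp (- \<gamma> * z) * (- \<gamma>) * (w * sin ((a + z) * w) - \<gamma> * cos ((a + z) * w)) +
         exp (- \<gamma> * z) * (w * (cos ((a + z) * w) * w) + \<gamma> * (sin ((a + z) * w) * w))) / (\<gamma>\<^sup>2 + w\<^sup>2)) (at z)"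
      unfolding F_def by (rule DERIV_cdivide) (auto intro!: derivative_eq_intros simp: algebra_simps)
    also have "(exp (- \<gamma> * z) * (- \<gamma>) * (w * sin ((a + z) * w) - \<gamma> * cos ((a + z) * w)) +
         exp (- \<gamma> * z) * (w * (cos ((a + z) * w) * w) + \<gamma> * (sin ((a + z) * w) * w))) =
        exp (- \<gamma> * z) * cos ((a + z) * w) * (\<gamma>\<^sup>2 + w\<^sup>2)"
      by (simp add: algebra_simps power2_eq_square)
    finally show ?thesis using \<gamma> by simp
  qed
  have lim0: "((F \<circ> real_of_ereal) \<longlongrightarrow> F 0) (at_right 0)"
  proof -
    have "(F \<longlongrightarrow> F 0) (at_right 0)"
      using DERIV_isCont[OF deriv] by (simp add: isCont_def filterlim_at_split)
    then show ?thesis by (simp add: zero_ereal_def ereal_tendsto_simps)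
  qed
  have liminf: "((F \<circ> real_of_ereal) \<longlongrightarrow> 0) (at_left \<infinity>)"
  proof -
    have "(F \<longlongrightarrow> 0) at_top"
    proof (rule Lim_null_comparison)
      have "\<bar>w * sin u - \<gamma> * cos u\<bar> \<le> \<bar>w\<bar> + \<gamma>" for u
      proof -
        have "\<bar>w * sin u\<bar> \<le> \<bar>w\<bar>" "\<bar>\<gamma> * cos u\<bar> \<le> \<gamma>"
          using \<gamma> by (auto simp: abs_mult intro!: mult_left_le)
        then show ?thesis by linarith
      qed
      then have "norm (F z) \<le> exp (- \<gamma> * z) * (\<bar>w\<bar> + \<gamma>) / (\<gamma>\<^sup>2 + w\<^sup>2)" for z
        using pos by (auto simp: F_def abs_mult intro!: divide_right_mono mult_left_mono)
      then show "\<forall>\<^sub>F z in at_top. norm (F z) \<le> exp (- \<gamma> * z) * ((\<bar>w\<bar> + \<gamma>) / (\<gamma>\<^sup>2 + w\<^sup>2))"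
        by simp
      show "((\<lambda>z. exp (- \<gamma> * z) * ((\<bar>w\<bar> + \<gamma>) / (\<gamma>\<^sup>2 + w\<^sup>2))) \<longlongrightarrow> 0) at_top"
        using \<gamma> by real_asymp
    qed
    then show ?thesis by (simp add: ereal_tendsto_simps)
  qed
  have "(LBINT z=0..\<infinity>. exp (- \<gamma> * z) * cos ((a + z) * w)) = 0 - F 0"
  proof (rule interval_integral_FTC_integrable)
    show "(F has_vector_derivative exp (- \<gamma> * z) * cos ((a + z) * w)) (at z)" for z
      using deriv[of z] by (simp add: has_real_derivative_iff_has_vector_derivative)
    show "set_integrable lborel (einterval 0 \<infinity>) (\<lambda>z. exp (- \<gamma> * z) * cos ((a + z) * w))"
      using int by (simp add: zero_ereal_def)
  qed (use lim0 liminf in \<open>auto intro!: continuous_intros\<close>)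
  then show ?thesis
    by (simp add: interval_lebesgue_integral_def zero_ereal_def F_def minus_divide_left)
qed

text \<open>
  The rational factor is the integral over the half line of \<open>exp (- \<gamma> z) cos ((a + z) w)\<close>. Exchanging
  this integral with the one over \<open>w\<close> leaves a Gaussian cosine transform. Absolute integrability needs
  \<open>\<gamma> > 0\<close>.
\<close>
lemma weighted_exp_cos_integral:
  assumes \<gamma>: "0 < \<gamma>" and t: "0 < t"
  shows "(LBINT w:{0<..}. exp (- t * w\<^sup>2 / 2) * ((\<gamma> * cos (a * w) - w * sin (a * w)) / (\<gamma>\<^sup>2 + w\<^sup>2))) =
    (LBINT z:{0<..}. exp (- \<gamma> * z) * (pi / sqrt t * std_normal_density ((a + z) / sqrt t)))"
proof -
  let ?E = "\<lambda>w. exp (- t * w\<^sup>2 / 2) :: real" and ?i = "indicator {0<..} :: real \<Rightarrow> real"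
  define f where "f w z = ?i w * ?E w * (?i z * exp (- \<gamma> * z)) * cos ((a + z) * w)" for w z
  have dom: "integrable (lborel \<Otimes>\<^sub>M lborel) (\<lambda>(w, z). ?E w * (?i z * exp (- \<gamma> * z)))"
  proof (rule lborel_pair.Fubini_integrable)
    have int: "integrable lborel (\<lambda>z. ?i z * exp (- \<gamma> * z))"
      using exp_decay_integrable[OF \<gamma>] by (simp add: set_integrable_def)
    then show "AE w in lborel. integrable lborel (\<lambda>z. (\<lambda>(w, z). ?E w * (?i z * exp (- \<gamma> * z))) (w, z))"
      by auto
    show "integrable lborel (\<lambda>w. \<integral>z. norm ((\<lambda>(w, z). ?E w * (?i z * exp (- \<gamma> * z))) (w, z)) \<partial>lborel)"
      using gaussian_weight_integrable[OF t] by (simp add: abs_mult)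
  qed simp
  have int: "integrable (lborel \<Otimes>\<^sub>M lborel) (\<lambda>(w, z). f w z)"
  proof (rule Bochner_Integration.integrable_bound[OF dom])
    show "(\<lambda>(w, z). f w z) \<in> borel_measurable (lborel \<Otimes>\<^sub>M lborel)"
      unfolding f_def by measurable
    show "AE x in lborel \<Otimes>\<^sub>M lborel. norm (case x of (w, z) \<Rightarrow> f w z) \<le>
        norm (case x of (w, z) \<Rightarrow> ?E w * (?i z * exp (- \<gamma> * z)))"
      by (auto simp: f_def abs_mult indicator_def intro!: mult_left_le)
  qed
  have "(LBINT w:{0<..}. ?E w * ((\<gamma> * cos (a * w) - w * sin (a * w)) / (\<gamma>\<^sup>2 + w\<^sup>2))) =
      (\<integral>w. ?i w * ?E w * (LBINT z:{0<..}. exp (- \<gamma> * z) * cos ((a + z) * w)) \<partial>lborel)"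
    unfolding exp_cos_half_line_integral[OF \<gamma>] by (simp add: set_lebesgue_integral_def mult.assoc)
  also have "\<dots> = (\<integral>w. (\<integral>z. f w z \<partial>lborel) \<partial>lborel)"
    unfolding f_def set_lebesgue_integral_def
    by (simp add: mult.assoc flip: integral_mult_right_zero)
  also have "\<dots> = (\<integral>z. (\<integral>w. f w z \<partial>lborel) \<partial>lborel)"
    by (rule lborel_pair.Fubini_integral[OF int, symmetric])
  also have "\<dots> = (\<integral>z. ?i z * exp (- \<gamma> * z) * (LBINT w:{0<..}. ?E w * cos ((a + z) * w)) \<partial>lborel)"
    unfolding f_def set_lebesgue_integral_def
    by (simp add: mult_ac flip: integral_mult_right_zero)
  finally show ?thesis
    unfolding gaussian_cosine_transform[OF t] by (simp add: set_lebesgue_integral_def mult.assoc)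
qed

text \<open>
  The exponential tilts the Gaussian, whose integral over the half line is then a normal tail.
\<close>
lemma exp_gaussian_half_line_integral:
  assumes t: "0 < t"
  shows "(LBINT z:{0<..}. exp (- \<gamma> * z) * (pi / sqrt t * std_normal_density ((a + z) / sqrt t))) =
    pi * exp (\<gamma> * a + \<gamma>\<^sup>2 * t / 2) * normal_tail ((a + \<gamma> * t) / sqrt t)"
proof -
  let ?v = "(a + \<gamma> * t) / sqrt t"
  have st: "0 < sqrt t" using t by simp
  have tilt: "exp (- \<gamma> * z) * std_normal_density ((a + z) / sqrt t) =
      exp (\<gamma> * a + \<gamma>\<^sup>2 * t / 2) * std_normal_density (?v + 1 / sqrt t * z)" for z
  proof -
    have "?v + 1 / sqrt t * z = (a + z - (- \<gamma>) * t) / sqrt t" by (simp add: add_divide_distrib)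
    then have "std_normal_density (?v + 1 / sqrt t * z) =
        exp (- \<gamma> * (a + z) - \<gamma>\<^sup>2 * t / 2) * std_normal_density ((a + z) / sqrt t)"
      using std_normal_density_tilt[OF t, of "- \<gamma>" "a + z"] by simp
    moreover have "exp (- \<gamma> * z) = exp (\<gamma> * a + \<gamma>\<^sup>2 * t / 2) * exp (- \<gamma> * (a + z) - \<gamma>\<^sup>2 * t / 2)"
      by (simp add: algebra_simps flip: exp_add)
    ultimately show ?thesis by simp
  qed
  have "normal_tail ?v = 1 / sqrt t * (\<integral>z. indicator {?v<..} (?v + 1 / sqrt t * z) * std_normal_density (?v + 1 / sqrt t * z) \<partial>lborel)"
    unfolding normal_tail_def set_lebesgue_integral_def
    by (subst lborel_integral_real_affine[where c="1 / sqrt t" and t="?v"]) (use st in auto)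
  also have "\<dots> = 1 / sqrt t * (LBINT z:{0<..}. std_normal_density (?v + 1 / sqrt t * z))"
    unfolding set_lebesgue_integral_def using st
    by (intro arg_cong2[where f="(*)"] refl Bochner_Integration.integral_cong)
      (auto simp: indicator_def zero_less_divide_iff)
  finally have tail: "(LBINT z:{0<..}. std_normal_density (?v + 1 / sqrt t * z)) = sqrt t * normal_tail ?v"
    using st by (simp add: field_simps)
  have "(LBINT z:{0<..}. exp (- \<gamma> * z) * (pi / sqrt t * std_normal_density ((a + z) / sqrt t))) =
      (LBINT z:{0<..}. pi / sqrt t * exp (\<gamma> * a + \<gamma>\<^sup>2 * t / 2) * std_normal_density (?v + 1 / sqrt t * z))"
    by (simp only: mult.left_commute[of _ "pi / sqrt t"] tilt mult.assoc)
  also have "\<dots> = pi / sqrt t * exp (\<gamma> * a + \<gamma>\<^sup>2 * t / 2) * (sqrt t * normal_tail ?v)"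
    unfolding set_integral_mult_right tail ..
  finally show ?thesis using st by (simp add: field_simps)
qed

text \<open>
  Here \<open>s\<close> and \<open>c\<close> stand for the sine and cosine of the frequency integrand. The first summand on the right is
  a cosine transform, the second has the form treated in \<open>weighted_exp_cos_integral\<close>.
\<close>
lemma frequency_integrand_split:
  fixes \<gamma> w :: real
  assumes "0 < w"
  shows "w * (\<gamma> * s + w * c) / (w\<^sup>2 / 2 + \<gamma>\<^sup>2 / 2) = 2 * c - 2 * \<gamma> * ((\<gamma> * c - w * s) / (\<gamma>\<^sup>2 + w\<^sup>2))"
proof -
  define p where "p = \<gamma>\<^sup>2 + w\<^sup>2"
  have "0 < p" unfolding p_def by (rule add_nonneg_pos) (use assms in auto)
  have *: "2 * (w * (\<gamma> * s + w * c)) = 2 * c * p - 2 * \<gamma> * (\<gamma> * c - w * s)"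
    by (simp add: p_def algebra_simps power2_eq_square)
  have "2 * (w * (\<gamma> * s + w * c)) / p = 2 * c - 2 * \<gamma> * ((\<gamma> * c - w * s) / p)"
  proof -
    have "(2 * c * p - 2 * \<gamma> * q) / p = 2 * c - 2 * \<gamma> * (q / p)" for q
      using \<open>0 < p\<close> by (simp add: diff_divide_distrib)
    then show ?thesis by (simp only: *)
  qed
  moreover have "w\<^sup>2 / 2 + \<gamma>\<^sup>2 / 2 = p / 2" by (simp add: p_def add_divide_distrib)
  ultimately show ?thesis by (simp only: p_def[symmetric]) (simp add: mult.commute[of _ 2])
qed

text \<open>
  The integrand splits into a cosine transform, which gives the Gaussian part of the density, and
  a multiple of \<open>\<gamma>\<close>, which gives the normal tail. The factor \<open>\<gamma>\<close> in the second part also covers the case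
  \<open>\<gamma> = 0\<close>, in which the exchange of integrals is not available.
\<close>
lemma frequency_integral:
  fixes a \<gamma> t :: real
  assumes \<gamma>: "0 \<le> \<gamma>" and t: "0 < t"
  defines "g \<equiv> \<lambda>w. w * (exp (- t * w\<^sup>2 / 2) / (w\<^sup>2 / 2 + \<gamma>\<^sup>2 / 2) * (\<gamma> * sin (a * w) + w * cos (a * w)))"
  shows "set_integrable lborel {0<..} g"
    and "(LBINT w:{0<..}. g w) = pi * exp (- \<gamma> * a + \<gamma>\<^sup>2 * t / 2) * max_density \<gamma> t a"
proof -
  let ?E = "\<lambda>w. exp (- t * w\<^sup>2 / 2) :: real"
  let ?k = "\<lambda>w. ?E w * ((\<gamma> * cos (a * w) - w * sin (a * w)) / (\<gamma>\<^sup>2 + w\<^sup>2))"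
  have split: "g w = 2 * (?E w * cos (a * w)) - 2 * (\<gamma> * ?k w)" if "w \<in> {0<..}" for w
  proof -
    have "g w = ?E w * (w * (\<gamma> * sin (a * w) + w * cos (a * w)) / (w\<^sup>2 / 2 + \<gamma>\<^sup>2 / 2))"
      by (simp add: g_def)
    also have "\<dots> = ?E w * (2 * cos (a * w) - 2 * \<gamma> * ((\<gamma> * cos (a * w) - w * sin (a * w)) / (\<gamma>\<^sup>2 + w\<^sup>2)))"
      using that by (subst frequency_integrand_split) auto
    finally show ?thesis by (simp only: right_diff_distrib mult_ac)
  qed
  have E: "set_integrable lborel {0<..} ?E"
    unfolding set_integrable_def using gaussian_weight_integrable[OF t] by (intro integrable_mult_indicator) auto
  have cos_int: "set_integrable lborel {0<..} (\<lambda>w. ?E w * cos (a * w))"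
    by (rule set_integrable_bound[OF E]) (auto simp: set_borel_measurable_def abs_mult intro!: mult_left_le)
  have k_int: "set_integrable lborel {0<..} (\<lambda>w. \<gamma> * ?k w)"
  proof (rule set_integrable_bound[OF set_integrable_mult_right[of 2, OF E]])
    show "set_borel_measurable lborel {0<..} (\<lambda>w. \<gamma> * ?k w)"
      unfolding set_borel_measurable_def by measurable
    show "AE w in lborel. w \<in> {0<..} \<longrightarrow> norm (\<gamma> * ?k w) \<le> norm (2 * ?E w)"
    proof (intro AE_I2 impI)
      fix w :: real assume "w \<in> {0<..}"
      then have w: "0 < w" by simp
      have pos: "0 < \<gamma>\<^sup>2 + w\<^sup>2" using w by (intro add_nonneg_pos) auto
      have "\<bar>\<gamma> * cos (a * w) - w * sin (a * w)\<bar> \<le> \<gamma> + w"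
      proof -
        have "\<bar>w * sin (a * w)\<bar> \<le> w" "\<bar>\<gamma> * cos (a * w)\<bar> \<le> \<gamma>"
          using \<gamma> w by (auto simp: abs_mult intro!: mult_left_le)
        then show ?thesis by linarith
      qed
      then have "\<gamma> * \<bar>\<gamma> * cos (a * w) - w * sin (a * w)\<bar> \<le> \<gamma> * (\<gamma> + w)"
        using \<gamma> by (rule mult_left_mono)
      also have "\<dots> \<le> 2 * (\<gamma>\<^sup>2 + w\<^sup>2)"
        using sum_squares_bound[of \<gamma> w] zero_le_square[of \<gamma>] zero_le_square[of w]
        unfolding power2_eq_square distrib_left by linarith
      finally have "\<gamma> * \<bar>\<gamma> * cos (a * w) - w * sin (a * w)\<bar> / (\<gamma>\<^sup>2 + w\<^sup>2) \<le> 2"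
        using pos by (simp add: pos_divide_le_eq)
      from mult_left_mono[OF this, of "?E w"] show "norm (\<gamma> * ?k w) \<le> norm (2 * ?E w)"
        using \<gamma> pos by (simp add: abs_mult mult_ac)
    qed
  qed
  note ints = set_integrable_mult_right[of 2, OF cos_int] set_integrable_mult_right[of 2, OF k_int]
  have cong: "set_integrable lborel {0<..} g \<longleftrightarrow>
      set_integrable lborel {0<..} (\<lambda>w. 2 * (?E w * cos (a * w)) - 2 * (\<gamma> * ?k w))"
    by (rule set_integrable_cong) (use split in auto)
  show "set_integrable lborel {0<..} g"
    unfolding cong using ints by (rule set_integral_diff)
  have K: "(LBINT w:{0<..}. \<gamma> * ?k w) =
      \<gamma> * (pi * exp (\<gamma> * a + \<gamma>\<^sup>2 * t / 2) * normal_tail ((a + \<gamma> * t) / sqrt t))"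
  proof (cases "\<gamma> = 0")
    case False
    then have "0 < \<gamma>" using \<gamma> by simp
    then show ?thesis
      by (simp only: set_integral_mult_right weighted_exp_cos_integral[OF _ t]
          exp_gaussian_half_line_integral[OF t])
  qed simp
  have "(LBINT w:{0<..}. g w) = (LBINT w:{0<..}. 2 * (?E w * cos (a * w)) - 2 * (\<gamma> * ?k w))"
    by (rule set_lebesgue_integral_cong) (use split in auto)
  also have "\<dots> = 2 * (LBINT w:{0<..}. ?E w * cos (a * w)) - 2 * (LBINT w:{0<..}. \<gamma> * ?k w)"
    by (simp only: set_integral_diff(2)[OF ints] set_integral_mult_right)
  also have "\<dots> = 2 * (pi / sqrt t * std_normal_density (a / sqrt t)) -
      2 * (\<gamma> * (pi * exp (\<gamma> * a + \<gamma>\<^sup>2 * t / 2) * normal_tail ((a + \<gamma> * t) / sqrt t)))"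
    by (simp only: gaussian_cosine_transform[OF t] K)
  also have "\<dots> = pi * exp (- \<gamma> * a + \<gamma>\<^sup>2 * t / 2) * max_density \<gamma> t a"
  proof -
    have "exp (- \<gamma> * a + \<gamma>\<^sup>2 * t / 2) * exp (\<gamma> * a - \<gamma>\<^sup>2 * t / 2) = 1"
      by (simp flip: exp_add)
    then have 1: "exp (- \<gamma> * a + \<gamma>\<^sup>2 * t / 2) * std_normal_density ((a - \<gamma> * t) / sqrt t) = std_normal_density (a / sqrt t)"
      by (simp only: std_normal_density_tilt[OF t, symmetric] mult.assoc[symmetric] mult_1_left)
    have 2: "exp (- \<gamma> * a + \<gamma>\<^sup>2 * t / 2) * exp (2 * \<gamma> * a) = exp (\<gamma> * a + \<gamma>\<^sup>2 * t / 2)"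
      by (simp flip: exp_add)
    show ?thesis
      unfolding max_density_def 1[symmetric] 2[symmetric] by (simp add: algebra_simps)
  qed
  finally show "(LBINT w:{0<..}. g w) = pi * exp (- \<gamma> * a + \<gamma>\<^sup>2 * t / 2) * max_density \<gamma> t a" .
qed

text \<open>
  In the application \<open>f\<close> changes sign, so its integrability has to be carried across the substitution
  together with the value of the integral.
\<close>
lemma set_integral_half_square_substitution:
  fixes f :: "real \<Rightarrow> real"
  assumes [measurable]: "f \<in> borel_measurable borel"
    and int: "set_integrable lborel {0<..} (\<lambda>w. w * f (w\<^sup>2 / 2))"
  shows "set_integrable lborel {0<..} f"
    and "(LBINT y:{0<..}. f y) = (LBINT w:{0<..}. w * f (w\<^sup>2 / 2))"
proof -
  let ?g = "\<lambda>w :: real. w\<^sup>2 / 2"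
  have img: "?g ` {0<..} = {0<..}"
  proof (intro equalityI subsetI)
    fix y :: real assume "y \<in> {0<..}"
    then have "y = ?g (sqrt (2 * y))" "sqrt (2 * y) \<in> {0<..}" by auto
    then show "y \<in> ?g ` {0<..}" by blast
  qed auto
  have inj: "inj_on ?g {0<..}" by (auto simp: inj_on_def power2_eq_iff)
  have conv: "set_integrable lborel {0<..} h \<longleftrightarrow> h absolutely_integrable_on {0<..}"
    if [measurable]: "h \<in> borel_measurable borel" for h :: "real \<Rightarrow> real"
    unfolding set_integrable_def by (rule integrable_completion[symmetric]) measurable
  have "(\<lambda>w. \<bar>w\<bar> * f (?g w)) absolutely_integrable_on {0<..} \<longleftrightarrow> (\<lambda>w. w * f (?g w)) absolutely_integrable_on {0<..}"
    unfolding set_integrable_def by (intro Bochner_Integration.integrable_cong) (auto simp: indicator_def)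
  then have abs: "(\<lambda>w. \<bar>w\<bar> * f (?g w)) absolutely_integrable_on {0<..}"
    using int by (simp add: conv)
  have "f absolutely_integrable_on ?g ` {0<..} \<and> integral (?g ` {0<..}) f = integral {0<..} (\<lambda>w. \<bar>w\<bar> * f (?g w))"
    by (rule iffD1[OF has_absolute_integral_change_of_variables_1'[OF _ _ inj]])
      (use abs in \<open>auto intro!: derivative_eq_intros\<close>)
  then have *: "f absolutely_integrable_on {0<..}" "integral {0<..} f = integral {0<..} (\<lambda>w. \<bar>w\<bar> * f (?g w))"
    unfolding img by auto
  show f: "set_integrable lborel {0<..} f" using *(1) by (simp add: conv)
  have "integral {0<..} (\<lambda>w. \<bar>w\<bar> * f (?g w)) = integral {0<..} (\<lambda>w. w * f (?g w))"
    by (rule integral_cong) auto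
  then show "(LBINT y:{0<..}. f y) = (LBINT w:{0<..}. w * f (?g w))"
    using *(2) set_borel_integral_eq_integral(2)[OF f] set_borel_integral_eq_integral(2)[OF int] by simp
qed

section \<open>First passage of a continuous path along a grid\<close>

lemma continuous_on_locally_greater:
  fixes f :: "real \<Rightarrow> real"
  assumes "continuous_on S f" "x \<in> S" "a < f x"
  obtains d where "0 < d" "\<And>u. u \<in> S \<Longrightarrow> \<bar>u - x\<bar> < d \<Longrightarrow> a < f u"
proof -
  obtain d where "0 < d" and d: "\<And>u. u \<in> S \<Longrightarrow> dist u x < d \<Longrightarrow> dist (f u) (f x) < f x - a"
    using assms by (meson continuous_on_iff diff_gt_0_iff_gt)
  show ?thesis
    using that[OF \<open>0 < d\<close>] d by (fastforce simp: dist_real_def abs_less_iff)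
qed

text \<open>
  The last grid point before \<open>s\<close> works: its distance from \<open>s\<close> is less than the mesh \<open>t / n\<close>, and it lies
  in \<open>[0, t]\<close>.
\<close>
lemma grid_point_near:
  fixes f :: "real \<Rightarrow> real"
  assumes cont: "continuous_on {0..t} f" and t: "0 < t" and s: "s \<in> {0..t}" "f s > a" and e: "0 < e"
  shows "\<forall>\<^sub>F n in sequentially. \<exists>k\<le>n. f (t * k / n) > a \<and> \<bar>t * k / n - s\<bar> < e"
proof -
  obtain d where d: "0 < d"
    and near: "\<And>u. u \<in> {0..t} \<Longrightarrow> \<bar>u - s\<bar> < d \<Longrightarrow> f u > a"
    using continuous_on_locally_greater[OF cont s] by blast
  define q where "q = min d e"
  have q: "0 < q" using d e by (simp add: q_def)
  have "\<forall>\<^sub>F n in sequentially. t / q < real n"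
    by real_asymp
  then show ?thesis
  proof (eventually_elim)
    case (elim n)
    have "0 < t / q" using t q by simp
    then have n: "0 < real n" using elim by linarith
    define k where "k = nat \<lfloor>real n * s / t\<rfloor>"
    have "0 \<le> real n * s / t" using s t by simp
    then have k: "real k \<le> real n * s / t" "real n * s / t < real k + 1"
      unfolding k_def by linarith+
    have kn: "t * k / n \<le> s" using k(1) n t by (simp add: field_simps)
    have "s < t * k / n + t / n" using k(2) n t by (simp add: field_simps)
    moreover have "t / n < q"
      using elim n q by (simp add: pos_divide_less_eq mult.commute)
    ultimately have less: "\<bar>t * k / n - s\<bar> < q" using kn by linarith
    have "real n * s / t \<le> real n" using s t n by (simp add: field_simps)
    then have "k \<le> n" using k(1) by linarith
    moreover have "f (t * k / n) > a" using near[of "t * k / n"] less kn s t n by (auto simp: q_def)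
    ultimately show ?case using less by (auto simp: q_def)
  qed
qed

definition first_index :: "(nat \<Rightarrow> real) \<Rightarrow> real \<Rightarrow> nat \<Rightarrow> bool" where
  "first_index x a k \<longleftrightarrow> x k > a \<and> (\<forall>i<k. x i \<le> a)"

lemma sum_first_index:
  fixes v :: "nat \<Rightarrow> real"
  shows "(\<Sum>k\<le>n. if first_index x a k then v k else 0) =
    (if \<exists>k\<le>n. x k > a then v (LEAST k. x k > a) else 0)"
proof (cases "\<exists>k\<le>n. x k > a")
  case True
  define m where "m = (LEAST k. x k > a)"
  have m: "x m > a" "m \<le> n" and least: "\<And>i. x i > a \<Longrightarrow> m \<le> i"
    using True unfolding m_def by (auto intro: LeastI Least_le order_trans)
  have iff: "first_index x a k \<longleftrightarrow> k = m" for k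
    unfolding first_index_def using m(1) least by (meson leD leI le_neq_implies_less)
  show ?thesis
    using True m by (simp add: iff m_def[symmetric] sum.delta)
next
  case False
  then show ?thesis by (auto simp: first_index_def intro!: sum.neutral)
qed

text \<open>
  The limit \<open>\<tau>\<close> is the infimum of the times at which the path exceeds \<open>a\<close>. Passage is defined by exceeding
  the level rather than reaching it, because a path that only touches \<open>a\<close> may do so between grid points for
  every \<open>n\<close>. If \<open>\<tau>\<close> were \<open>t\<close>, the path would exceed \<open>a\<close> at \<open>t\<close> alone, against \<open>f \<tau> = a\<close>.
\<close>
lemma grid_passage_times_converge:
  fixes f :: "real \<Rightarrow> real"
  assumes cont: "continuous_on {0..t} f" and t: "0 < t" and f0: "f 0 \<le> a"
    and ex: "s \<in> {0..t}" "f s > a"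
  obtains \<tau> where "\<tau> < t" "f \<tau> = a" "\<tau> \<in> {0..t}"
    "\<forall>\<^sub>F n in sequentially. \<exists>k\<le>n. f (t * real k / n) > a"
    "(\<lambda>n. t * real (LEAST k. f (t * real k / n) > a) / n) \<longlonglongrightarrow> \<tau>"
proof -
  define S where "S = {s \<in> {0..t}. f s > a}"
  define \<tau> where "\<tau> = Inf S"
  have S: "S \<noteq> {}" "bdd_below S" using ex by (auto simp: S_def bdd_below_def)
  have \<tau>: "\<tau> \<in> {0..t}"
    using ex cInf_lower[OF _ S(2), of s] cInf_greatest[OF S(1), of 0]
    by (auto simp: \<tau>_def S_def)
  have lower: "\<tau> \<le> u" if "u \<in> {0..t}" "f u > a" for u
    unfolding \<tau>_def using that S by (intro cInf_lower) (auto simp: S_def)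
  have approx: "\<exists>u\<in>{0..t}. f u > a \<and> u < \<tau> + e" if "0 < e" for e
    using cInf_lessD[OF S(1), of "\<tau> + e"] that by (auto simp: \<tau>_def S_def)
  have le: "f \<tau> \<le> a"
  proof (rule ccontr)
    assume "\<not> f \<tau> \<le> a"
    then have gt: "f \<tau> > a" by simp
    then have "0 < \<tau>" using f0 \<tau> by (cases "\<tau> = 0") auto
    obtain d where d: "0 < d"
      and near: "\<And>u. u \<in> {0..t} \<Longrightarrow> \<bar>u - \<tau>\<bar> < d \<Longrightarrow> f u > a"
      using continuous_on_locally_greater[OF cont \<tau> gt] by blast
    have "f (\<tau> - min (d / 2) \<tau>) > a"
      using near[of "\<tau> - min (d / 2) \<tau>"] d \<tau> \<open>0 < \<tau>\<close> by (auto simp: min_def)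
    then show False using lower[of "\<tau> - min (d / 2) \<tau>"] d \<tau> \<open>0 < \<tau>\<close> by (auto simp: min_def split: if_splits)
  qed
  have ge: "f \<tau> \<ge> a"
  proof (rule ccontr)
    assume "\<not> f \<tau> \<ge> a"
    then have lt: "f \<tau> < a" by simp
    obtain d where d: "0 < d"
      and near: "\<And>u. u \<in> {0..t} \<Longrightarrow> \<bar>u - \<tau>\<bar> < d \<Longrightarrow> f u < a"
      using continuous_on_locally_greater[of _ "\<lambda>u. - f u" \<tau> "- a"] cont lt \<tau>
      by (metis continuous_on_minus neg_less_iff_less)
    obtain u where "u \<in> {0..t}" "f u > a" "u < \<tau> + d" using approx[OF d] by auto
    then show False using near[of u] lower[of u] by auto
  qed
  have "\<tau> \<noteq> t"
  proof
    assume "\<tau> = t"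
    then have "s = \<tau>" using lower[OF ex] ex by auto
    then show False using le ex by simp
  qed
  have hit: "\<forall>\<^sub>F n in sequentially. \<exists>k\<le>n. f (t * real k / n) > a"
    using grid_point_near[OF cont t ex zero_less_one] by (auto elim!: eventually_mono)
  have conv: "(\<lambda>n. t * real (LEAST k. f (t * real k / n) > a) / n) \<longlonglongrightarrow> \<tau>"
  proof (rule tendstoI)
    fix e :: real assume e: "0 < e"
    then obtain u where u: "u \<in> {0..t}" "f u > a" "u < \<tau> + e / 2" using approx[of "e / 2"] by auto
    from e have "0 < e / 2" by simp
    from grid_point_near[OF cont t u(1,2) this]
    show "\<forall>\<^sub>F n in sequentially. dist (t * real (LEAST k. f (t * real k / n) > a) / n) \<tau> < e"
    proof eventually_elim
      case (elim n)
      then obtain k where k: "k \<le> n" "f (t * k / n) > a" "\<bar>t * k / n - u\<bar> < e / 2" by auto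
      define m where "m = (LEAST k. f (t * real k / n) > a)"
      have m: "f (t * real m / n) > a" "m \<le> k"
        unfolding m_def using k(2) by (auto intro: LeastI Least_le)
      have mk: "t * real m / n \<le> t * k / n"
        using m t by (intro divide_right_mono mult_left_mono) auto
      have "t * real m / n \<le> t"
        using m(2) k(1) t by (cases "n = 0") (auto simp: field_simps)
      then have "\<tau> \<le> t * real m / n" using m(1) t by (intro lower) auto
      then have "\<bar>t * real m / n - \<tau>\<bar> < e"
        using mk k(3) u(3) by linarith
      then show ?case by (simp add: m_def[symmetric] dist_real_def)
    qed
  qed
  show ?thesis
    using that[of \<tau>] le ge \<tau> \<open>\<tau> \<noteq> t\<close> hit conv by auto
qed

section \<open>The reflection principle for Brownian motion with drift\<close>

context standard_brownian_motion
begin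

lemma expectation_increment:
  fixes g :: "real \<Rightarrow> real"
  assumes s: "0 \<le> s" "s \<le> t" and [measurable]: "g \<in> borel_measurable borel"
  shows "(\<integral>\<omega>. g (B t \<omega> - B s \<omega>) \<partial>M) = (LINT x|std_normal_distribution. g (sqrt (t - s) * x))"
proof (cases "s = t")
  case True
  interpret N: real_distribution std_normal_distribution by (rule real_dist_normal_dist)
  show ?thesis using True prob_space N.prob_space by simp
next
  case False
  then have st: "0 < sqrt (t - s)" using s by simp
  have scale: "sqrt (t - s) * normal_density 0 (sqrt (t - s)) (0 + sqrt (t - s) * x) = std_normal_density x" for x
  proof -
    have "\<sigma> * normal_density 0 \<sigma> (0 + \<sigma> * x) = std_normal_density x" if "0 < \<sigma>" for \<sigma>
      using that by (simp add: normal_density_def power_mult_distrib real_sqrt_mult)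
    then show ?thesis using st by blast
  qed
  have "(\<integral>\<omega>. g (B t \<omega> - B s \<omega>) \<partial>M) = (\<integral>x. normal_density 0 (sqrt (t - s)) x * g x \<partial>lborel)"
    using gaussian_increments[of s t] s False
    by (subst distributed_integral[symmetric, where f="normal_density 0 (sqrt (t - s))"]) auto
  also have "\<dots> = sqrt (t - s) * (\<integral>x. normal_density 0 (sqrt (t - s)) (0 + sqrt (t - s) * x) * g (0 + sqrt (t - s) * x) \<partial>lborel)"
    by (subst lborel_integral_real_affine[where c="sqrt (t - s)" and t=0]) (use st in auto)
  also have "\<dots> = (\<integral>x. sqrt (t - s) * (normal_density 0 (sqrt (t - s)) (0 + sqrt (t - s) * x) * g (0 + sqrt (t - s) * x)) \<partial>lborel)"
    by (rule integral_mult_right_zero[symmetric])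
  also have "\<dots> = (\<integral>x. std_normal_density x * g (sqrt (t - s) * x) \<partial>lborel)"
    using scale by (simp add: mult.assoc[symmetric])
  also have "\<dots> = (LINT x|std_normal_distribution. g (sqrt (t - s) * x))"
    by (subst integral_density) auto
  finally show ?thesis .
qed

text \<open>
  The grid is cut at index \<open>k\<close> and continued by the single time \<open>t\<close>, so that the increment up to \<open>t\<close> is one
  member of an independent family whose other members determine the path up to \<open>r k\<close>. It is kept as a
  function on \<open>{k}\<close> because \<open>indep_var\<close> requires both variables to have the same type.
\<close>
lemma indep_grid_increments:
  fixes r :: "nat \<Rightarrow> real"
  assumes r: "mono r" "r 0 = 0" "r k \<le> t"
  shows "indep_var (PiM {..k} (\<lambda>_. borel)) (\<lambda>\<omega>. \<lambda>i\<in>{..k}. B (r i) \<omega> - B 0 \<omega>)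
    (PiM {k} (\<lambda>_. borel)) (\<lambda>\<omega>. \<lambda>_\<in>{k}. B t \<omega> - B (r k) \<omega>)"
proof -
  define \<tau> where "\<tau> i = (if i \<le> k then r i else t)" for i
  define D where "D i \<omega> = B (\<tau> (Suc i)) \<omega> - B (\<tau> i) \<omega>" for i \<omega>
  have "mono \<tau>"
    unfolding mono_def \<tau>_def using monoD[OF r(1)] r(3) by (auto intro: order_trans)
  moreover have "0 \<le> \<tau> 0" using r by (simp add: \<tau>_def)
  ultimately have "indep_vars (\<lambda>_. borel) D {..<Suc k}"
    unfolding D_def by (rule indep_increments[rotated])
  then have indep: "indep_var (PiM {..<k} (\<lambda>_. borel)) (\<lambda>\<omega>. \<lambda>i\<in>{..<k}. D i \<omega>)
      (PiM {k} (\<lambda>_. borel)) (\<lambda>\<omega>. \<lambda>i\<in>{k}. D i \<omega>)"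
    by (rule indep_var_restrict) auto
  define c where "c y = (\<lambda>i\<in>{..k}. \<Sum>j<i. y j)" for y :: "nat \<Rightarrow> real"
  have c: "c \<in> measurable (PiM {..<k} (\<lambda>_. borel)) (PiM {..k} (\<lambda>_. borel))"
    unfolding c_def by (intro measurable_restrict borel_measurable_sum measurable_component_singleton) auto
  have "indep_var (PiM {..k} (\<lambda>_. borel)) (c \<circ> (\<lambda>\<omega>. \<lambda>i\<in>{..<k}. D i \<omega>))
      (PiM {k} (\<lambda>_. borel)) (id \<circ> (\<lambda>\<omega>. \<lambda>i\<in>{k}. D i \<omega>))"
    by (rule indep_var_compose[OF indep c]) simp
  moreover have "c \<circ> (\<lambda>\<omega>. \<lambda>i\<in>{..<k}. D i \<omega>) = (\<lambda>\<omega>. \<lambda>i\<in>{..k}. B (r i) \<omega> - B 0 \<omega>)"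
  proof (intro ext)
    fix \<omega> i
    have "(\<Sum>j<i. D j \<omega>) = B (\<tau> i) \<omega> - B (\<tau> 0) \<omega>"
      unfolding D_def by (rule sum_lessThan_telescope)
    then show "(c \<circ> (\<lambda>\<omega>. \<lambda>i\<in>{..<k}. D i \<omega>)) \<omega> i = (\<lambda>i\<in>{..k}. B (r i) \<omega> - B 0 \<omega>) i"
      by (auto simp: c_def \<tau>_def r restrict_def intro!: sum.cong)
  qed
  moreover have "id \<circ> (\<lambda>\<omega>. \<lambda>i\<in>{k}. D i \<omega>) = (\<lambda>\<omega>. \<lambda>_\<in>{k}. B t \<omega> - B (r k) \<omega>)"
    by (auto simp: D_def \<tau>_def restrict_def fun_eq_iff)
  ultimately show ?thesis by simp
qed

text \<open>
  The Markov property at a grid time: given the grid values up to \<open>r k\<close>, the increment up to \<open>t\<close> can be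
  integrated out against its normal law. The independence above concerns \<open>B - B 0\<close>, which agrees
  with \<open>B\<close> almost surely.
\<close>
lemma grid_markov:
  fixes \<Phi> :: "(nat \<Rightarrow> real) \<times> real \<Rightarrow> real"
  assumes r: "mono r" "r 0 = 0" "r k \<le> t"
    and \<Phi>[measurable]: "\<Phi> \<in> borel_measurable (PiM {..k} (\<lambda>_. borel) \<Otimes>\<^sub>M borel)"
    and bound: "\<And>p. \<bar>\<Phi> p\<bar> \<le> C"
  shows "(\<integral>\<omega>. \<Phi> (\<lambda>i\<in>{..k}. B (r i) \<omega>, B t \<omega> - B (r k) \<omega>) \<partial>M) =
    (\<integral>\<omega>. (LINT x|std_normal_distribution. \<Phi> (\<lambda>i\<in>{..k}. B (r i) \<omega>, sqrt (t - r k) * x)) \<partial>M)"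
proof -
  interpret N: real_distribution std_normal_distribution by (rule real_dist_normal_dist)
  define P where "P = PiM {..k} (\<lambda>_. borel :: real measure)"
  define Y where "Y \<omega> = (\<lambda>i\<in>{..k}. B (r i) \<omega> - B 0 \<omega>)" for \<omega>
  define Y' where "Y' \<omega> = (\<lambda>i\<in>{..k}. B (r i) \<omega>)" for \<omega>
  define Z where "Z \<omega> = B t \<omega> - B (r k) \<omega>" for \<omega>
  have r0: "0 \<le> r i" for i using monoD[OF r(1), of 0 i] r(2) by simp
  have [measurable]: "\<Phi> \<in> borel_measurable (P \<Otimes>\<^sub>M borel)" using \<Phi> by (simp add: P_def)
  have [measurable]: "Y' \<in> measurable M P"
    unfolding Y'_def P_def using r0 measurable by (intro measurable_restrict) auto
  define Q where "Q = PiM {k} (\<lambda>_. borel :: real measure)"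
  define Z' where "Z' \<omega> = (\<lambda>_\<in>{k}. Z \<omega>)" for \<omega>
  have Z'k: "Z' \<omega> k = Z \<omega>" for \<omega> by (simp add: Z'_def)
  have [measurable]: "(\<lambda>z. z k) \<in> borel_measurable Q"
    unfolding Q_def by (rule measurable_component_singleton) simp
  have iv: "indep_var P Y Q Z'"
    unfolding P_def Q_def Y_def Z'_def Z_def by (rule indep_grid_increments[OF r])
  then have [measurable]: "Y \<in> measurable M P" "Z' \<in> measurable M Q"
    and eq: "distr M P Y \<Otimes>\<^sub>M distr M Q Z' = distr M (P \<Otimes>\<^sub>M Q) (\<lambda>x. (Y x, Z' x))"
    by (auto simp: indep_var_distribution_eq)
  have AE: "AE \<omega> in M. Y \<omega> = Y' \<omega>"
    using start by eventually_elim (simp add: Y_def Y'_def)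
  interpret DY: prob_space "distr M P Y" by (rule prob_space_distr) measurable
  interpret DZ: prob_space "distr M Q Z'" by (rule prob_space_distr) measurable
  interpret D: pair_prob_space "distr M P Y" "distr M Q Z'" ..
  have [measurable]: "Z \<in> borel_measurable M" using measurable_compose[of Z' M Q "\<lambda>z. z k" borel] by (simp add: Z'k)
  have int: "integrable (distr M P Y \<Otimes>\<^sub>M distr M Q Z') (\<lambda>(y, z). \<Phi> (y, z k))"
    using bound by (intro D.integrable_const_bound[where B=C]) auto
  have inner: "(\<integral>\<omega>'. \<Phi> (y, Z \<omega>') \<partial>M) = (LINT x|std_normal_distribution. \<Phi> (y, sqrt (t - r k) * x))"
    if y: "y \<in> space P" for y
  proof -
    have "(\<lambda>z. \<Phi> (y, z)) \<in> borel_measurable borel"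
      using y by measurable
    from expectation_increment[OF _ r(3) this] show ?thesis
      using r0 by (simp add: Z_def)
  qed
  have [measurable]: "(\<lambda>y. LINT x|std_normal_distribution. \<Phi> (y, sqrt (t - r k) * x)) \<in> borel_measurable P"
    by measurable
  have "(\<integral>\<omega>. \<Phi> (Y' \<omega>, Z \<omega>) \<partial>M) = (\<integral>\<omega>. \<Phi> (Y \<omega>, Z \<omega>) \<partial>M)"
    by (rule integral_cong_AE) (use AE in \<open>auto elim!: eventually_mono\<close>)
  also have "\<dots> = (\<integral>p. \<Phi> (fst p, snd p k) \<partial>(distr M P Y \<Otimes>\<^sub>M distr M Q Z'))"
    unfolding eq by (subst integral_distr) (auto simp: Z'k)
  also have "\<dots> = (\<integral>y. (\<integral>z. \<Phi> (y, z k) \<partial>distr M Q Z') \<partial>distr M P Y)"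
    using D.integral_fst'[OF int, symmetric] by (simp add: case_prod_unfold)
  also have "\<dots> = (\<integral>y. (LINT x|std_normal_distribution. \<Phi> (y, sqrt (t - r k) * x)) \<partial>distr M P Y)"
    by (intro Bochner_Integration.integral_cong refl) (simp add: integral_distr Z'k inner)
  also have "\<dots> = (\<integral>\<omega>. (LINT x|std_normal_distribution. \<Phi> (Y \<omega>, sqrt (t - r k) * x)) \<partial>M)"
    by (subst integral_distr) auto
  also have "\<dots> = (\<integral>\<omega>. (LINT x|std_normal_distribution. \<Phi> (Y' \<omega>, sqrt (t - r k) * x)) \<partial>M)"
    by (rule integral_cong_AE) (use AE in \<open>auto elim!: eventually_mono\<close>)
  finally show ?thesis unfolding Y'_def Z_def .
qed

text \<open>
  Optional stopping at the first grid index above \<open>a\<close>. A positive payoff at time \<open>t\<close> means that \<open>t\<close> itself, the last grid point, is above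
  \<open>a\<close>, so the payoff is the sum of its restrictions to the values of that
  index, and the Markov property replaces each restriction by the value function at the grid time.
\<close>
lemma grid_reflection:
  assumes \<gamma>: "0 \<le> \<gamma>" and t: "0 \<le> t" and n: "0 < n"
  defines "X \<equiv> \<lambda>n \<omega> k. B (t * real k / real n) \<omega> + \<gamma> * (t * real k / real n)"
  shows "(\<integral>\<omega>. (\<Sum>k\<le>n. if first_index (X n \<omega>) a k
      then reflected_value \<gamma> (t - t * real k / real n) (X n \<omega> k - a) else 0) \<partial>M) =
    (\<integral>\<omega>. reflected_payoff \<gamma> (B t \<omega> + \<gamma> * t - a) \<partial>M)"
proof -
  define r where "r k = t * real k / real n" for k
  have r: "mono r" "r 0 = 0" and rn: "r n = t"
    using t n by (auto simp: r_def mono_def intro!: divide_right_mono mult_left_mono)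
  have r0: "0 \<le> r k" for k using t by (simp add: r_def)
  have X: "X n \<omega> = (\<lambda>k. B (r k) \<omega> + \<gamma> * r k)" for \<omega> by (simp add: X_def r_def)
  define Y where "Y k \<omega> = (if first_index (X n \<omega>) a k then reflected_value \<gamma> (t - r k) (X n \<omega> k - a) else 0)" for k \<omega>
  define Z where "Z k \<omega> = (if first_index (X n \<omega>) a k then reflected_payoff \<gamma> (B t \<omega> + \<gamma> * t - a) else 0)" for k \<omega>
  have [measurable]: "B (r i) \<in> borel_measurable M" "B t \<in> borel_measurable M" for i
    using r0 t measurable by auto
  have [measurable]: "Measurable.pred M (\<lambda>\<omega>. first_index (\<lambda>k. B (r k) \<omega> + \<gamma> * r k) a k)" for k
    unfolding first_index_def by measurable
  have [measurable]: "Y k \<in> borel_measurable M" "Z k \<in> borel_measurable M" for k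
    unfolding Y_def Z_def X by measurable
  have int: "integrable M (Y k)" "integrable M (Z k)" for k
    using reflected_value_bounds[OF \<gamma>] reflected_payoff_bounds[OF \<gamma>]
    by (auto intro!: integrable_const_bound[where B=2] simp: Y_def Z_def)
  have eq: "(\<integral>\<omega>. Z k \<omega> \<partial>M) = (\<integral>\<omega>. Y k \<omega> \<partial>M)" if k: "k \<le> n" for k
  proof -
    define \<Phi> where "\<Phi> = (\<lambda>(p, d). if first_index (\<lambda>i. p i + \<gamma> * r i) a k
      then reflected_payoff \<gamma> (p k + \<gamma> * r k - a + \<gamma> * (t - r k) + d) else 0)"
    have comp: "(\<lambda>p. fst p i) \<in> borel_measurable (PiM {..k} (\<lambda>_. borel) \<Otimes>\<^sub>M borel)" if "i \<le> k" for i
      using that by (intro measurable_compose[OF measurable_fst measurable_component_singleton]) auto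
    have "Measurable.pred (PiM {..k} (\<lambda>_. borel) \<Otimes>\<^sub>M borel) (\<lambda>p. \<forall>i\<in>{..<k}. fst p i + \<gamma> * r i \<le> a)"
      using comp by (intro pred_intros_finite) auto
    moreover have "Measurable.pred (PiM {..k} (\<lambda>_. borel) \<Otimes>\<^sub>M borel) (\<lambda>p. fst p k + \<gamma> * r k > a)"
      using comp[of k] by (intro borel_measurable_pred_less borel_measurable_add) auto
    ultimately have fi_meas: "Measurable.pred (PiM {..k} (\<lambda>_. borel) \<Otimes>\<^sub>M borel)
        (\<lambda>p. first_index (\<lambda>i. fst p i + \<gamma> * r i) a k)"
      unfolding first_index_def Ball_def lessThan_iff by (intro pred_intros_logic)
    have "(\<lambda>p. fst p k + \<gamma> * r k - a + \<gamma> * (t - r k) + snd p)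
        \<in> borel_measurable (PiM {..k} (\<lambda>_. borel) \<Otimes>\<^sub>M borel)"
      using comp[of k] by (intro borel_measurable_add borel_measurable_diff) auto
    from measurable_compose[OF this reflected_payoff_measurable]
    have \<Phi>_meas: "\<Phi> \<in> borel_measurable (PiM {..k} (\<lambda>_. borel) \<Otimes>\<^sub>M borel)"
      unfolding \<Phi>_def case_prod_unfold by (intro measurable_If fi_meas[unfolded pred_def] measurable_const) auto
    have le2: "\<bar>\<Phi> p\<bar> \<le> 2" for p
      using reflected_payoff_bounds[OF \<gamma>] by (auto simp: \<Phi>_def split: prod.split)
    have rk: "r k \<le> t" using monoD[OF r(1) k] rn by simp
    have fi: "first_index (\<lambda>i. (\<lambda>i\<in>{..k}. B (r i) \<omega>) i + \<gamma> * r i) a k = first_index (X n \<omega>) a k" for \<omega>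
      by (auto simp: first_index_def X)
    have \<Phi>_eq: "\<Phi> (\<lambda>i\<in>{..k}. B (r i) \<omega>, d) = (if first_index (X n \<omega>) a k
        then reflected_payoff \<gamma> (B (r k) \<omega> + \<gamma> * r k - a + \<gamma> * (t - r k) + d) else 0)" for \<omega> d
      by (simp only: \<Phi>_def prod.case fi) simp
    have "(\<integral>\<omega>. Z k \<omega> \<partial>M) = (\<integral>\<omega>. \<Phi> (\<lambda>i\<in>{..k}. B (r i) \<omega>, B t \<omega> - B (r k) \<omega>) \<partial>M)"
    proof -
      have "B (r k) \<omega> + \<gamma> * r k - a + \<gamma> * (t - r k) + (B t \<omega> - B (r k) \<omega>) = B t \<omega> + \<gamma> * t - a" for \<omega>
        by (simp add: algebra_simps)
      then show ?thesis by (simp only: Z_def \<Phi>_eq)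
    qed
    also have "\<dots> = (\<integral>\<omega>. (LINT x|std_normal_distribution. \<Phi> (\<lambda>i\<in>{..k}. B (r i) \<omega>, sqrt (t - r k) * x)) \<partial>M)"
      by (rule grid_markov[OF r rk \<Phi>_meas le2])
    also have "\<dots> = (\<integral>\<omega>. Y k \<omega> \<partial>M)"
      by (intro Bochner_Integration.integral_cong refl)
        (simp add: Y_def \<Phi>_eq, simp add: X reflected_value_def)
    finally show ?thesis .
  qed
  have "(\<integral>\<omega>. (\<Sum>k\<le>n. Y k \<omega>) \<partial>M) = (\<integral>\<omega>. (\<Sum>k\<le>n. Z k \<omega>) \<partial>M)"
    using int eq by (simp add: Bochner_Integration.integral_sum)
  also have "\<dots> = (\<integral>\<omega>. reflected_payoff \<gamma> (B t \<omega> + \<gamma> * t - a) \<partial>M)"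
  proof (intro Bochner_Integration.integral_cong refl)
    fix \<omega>
    have "X n \<omega> n = B t \<omega> + \<gamma> * t" by (simp add: X rn)
    then show "(\<Sum>k\<le>n. Z k \<omega>) = reflected_payoff \<gamma> (B t \<omega> + \<gamma> * t - a)"
      unfolding Z_def by (subst sum_first_index) (auto simp: reflected_payoff_def not_less)
  qed
  finally show ?thesis unfolding Y_def r_def .
qed

text \<open>
  As the grid is refined, the value function at the first grid passage tends to \<open>1\<close> on the paths that exceed \<open>a\<close>
  and is absent on the others, so the sum in \<open>grid_reflection\<close> converges to an indicator.
\<close>
lemma running_maximum_tail:
  assumes \<gamma>: "0 \<le> \<gamma>" and t: "0 < t" and a: "0 \<le> a"
  shows "{\<omega> \<in> space M. \<exists>s\<in>{0..t}. B s \<omega> + \<gamma> * s > a} \<in> sets M" (is "?A \<in> _")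
    and "prob {\<omega> \<in> space M. \<exists>s\<in>{0..t}. B s \<omega> + \<gamma> * s > a} = reflected_value \<gamma> t (- a)"
proof -
  define X where "X = (\<lambda>n \<omega> k. B (t * real k / real n) \<omega> + \<gamma> * (t * real k / real n))"
  define R where "R n \<omega> = (\<Sum>k\<le>n. if first_index (X n \<omega>) a k
      then reflected_value \<gamma> (t - t * real k / real n) (X n \<omega> k - a) else 0)" for n \<omega>
  have grid: "t * real k / real n \<in> {0..t}" if "k \<le> n" for k n
    using that t by (cases "n = 0") (auto simp: field_simps)
  have cont: "continuous_on {0..t} (\<lambda>s. B s \<omega> + \<gamma> * s)" if "\<omega> \<in> space M" for \<omega>
    using continuous_on_subset[OF continuous_paths[OF that]] by (intro continuous_intros) auto
  have [measurable]: "B (t * real i / real n) \<in> borel_measurable M" "B t \<in> borel_measurable M" for i n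
    using t measurable by auto
  have "?A = {\<omega> \<in> space M. \<exists>n. \<exists>k\<in>{..n}. X n \<omega> k > a}"
  proof (intro Collect_cong conj_cong refl iffI)
    fix \<omega> assume "\<omega> \<in> space M" "\<exists>s\<in>{0..t}. B s \<omega> + \<gamma> * s > a"
    then obtain s where "s \<in> {0..t}" "B s \<omega> + \<gamma> * s > a" by auto
    from eventually_happens'[OF _ grid_point_near[OF cont[OF \<open>\<omega> \<in> space M\<close>] t this zero_less_one]]
    show "\<exists>n. \<exists>k\<in>{..n}. X n \<omega> k > a" unfolding X_def by auto
  next
    fix \<omega> assume "\<exists>n. \<exists>k\<in>{..n}. X n \<omega> k > a"
    then show "\<exists>s\<in>{0..t}. B s \<omega> + \<gamma> * s > a" using grid unfolding X_def by blast
  qed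
  also have "\<dots> \<in> sets M" unfolding X_def by measurable
  finally show A[measurable]: "?A \<in> sets M" .
  have Rm[measurable]: "R n \<in> borel_measurable M" for n
    unfolding R_def first_index_def X_def by measurable
  have lim: "AE \<omega> in M. (\<lambda>n. R n \<omega>) \<longlonglongrightarrow> indicator ?A \<omega>"
    using start AE_space
  proof eventually_elim
    case (elim \<omega>)
    define f where "f s = B s \<omega> + \<gamma> * s" for s
    have f: "continuous_on {0..t} f" "f 0 \<le> a"
      using cont[OF elim(2)] elim(1) a by (simp_all add: f_def[abs_def])
    have Xf: "X n \<omega> = (\<lambda>k. f (t * real k / real n))" for n by (simp add: X_def f_def fun_eq_iff)
    show ?case
    proof (cases "\<exists>s\<in>{0..t}. f s > a")
      case True
      then obtain s where s: "s \<in> {0..t}" "f s > a" by auto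
      obtain \<tau> where \<tau>: "\<tau> < t" "f \<tau> = a" "\<tau> \<in> {0..t}"
        and hit: "\<forall>\<^sub>F n in sequentially. \<exists>k\<le>n. f (t * real k / n) > a"
        and conv: "(\<lambda>n. t * real (LEAST k. f (t * real k / n) > a) / n) \<longlonglongrightarrow> \<tau>"
        using grid_passage_times_converge[OF f(1) t f(2) s] .
      define \<tau>' where "\<tau>' n = t * real (LEAST k. f (t * real k / n) > a) / real n" for n :: nat
      have \<tau>': "\<tau>' \<longlonglongrightarrow> \<tau>" using conv by (simp add: \<tau>'_def[abs_def])
      have in_grid: "\<forall>\<^sub>F n in sequentially. \<tau>' n \<in> {0..t}"
        using hit
      proof eventually_elim
        case (elim n)
        then have "(LEAST k. f (t * real k / n) > a) \<le> n" by (auto intro: order_trans Least_le)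
        then show ?case unfolding \<tau>'_def by (rule grid)
      qed
      have "(\<lambda>n. f (\<tau>' n)) \<longlonglongrightarrow> f \<tau>"
        by (rule continuous_on_tendsto_compose[OF f(1) \<tau>' \<tau>(3) in_grid])
      then have "(\<lambda>n. f (\<tau>' n) - a) \<longlonglongrightarrow> 0" using tendsto_diff[OF _ tendsto_const, of _ "f \<tau>" _ a] \<tau>(2) by fastforce
      then have "(\<lambda>n. reflected_value \<gamma> (t - \<tau>' n) (f (\<tau>' n) - a)) \<longlonglongrightarrow> 1"
        using \<tau>' \<tau>(1) by (intro reflected_value_tendsto_1[where L="t - \<tau>"]) (auto intro!: tendsto_intros)
      moreover have "\<forall>\<^sub>F n in sequentially. reflected_value \<gamma> (t - \<tau>' n) (f (\<tau>' n) - a) = R n \<omega>"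
        using hit by eventually_elim (simp add: R_def sum_first_index Xf \<tau>'_def)
      ultimately have "(\<lambda>n. R n \<omega>) \<longlonglongrightarrow> 1" by (rule Lim_transform_eventually)
      then show ?thesis using True elim(2) by (simp add: f_def)
    next
      case False
      then have "\<not> (\<exists>k\<le>n. X n \<omega> k > a)" for n using grid unfolding Xf by blast
      then have "R n \<omega> = 0" for n by (simp only: R_def sum_first_index if_False)
      then show ?thesis using False elim(2) by (simp add: f_def)
    qed
  qed
  have bound: "\<bar>R n \<omega>\<bar> \<le> 2" for n \<omega>
    unfolding R_def sum_first_index using reflected_value_bounds[OF \<gamma>] by auto
  have "(\<lambda>n. \<integral>\<omega>. R n \<omega> \<partial>M) \<longlonglongrightarrow> (\<integral>\<omega>. indicator ?A \<omega> \<partial>M)"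
    by (rule integral_dominated_convergence[where w="\<lambda>_. 2"]) (use lim bound in auto)
  moreover have "\<forall>\<^sub>F n in sequentially. (\<integral>\<omega>. R n \<omega> \<partial>M) = (\<integral>\<omega>. reflected_payoff \<gamma> (B t \<omega> + \<gamma> * t - a) \<partial>M)"
    using eventually_gt_at_top[of 0]
    by eventually_elim (unfold R_def X_def, rule grid_reflection[OF \<gamma> less_imp_le[OF t]], simp)
  ultimately have "(\<lambda>n::nat. \<integral>\<omega>. reflected_payoff \<gamma> (B t \<omega> + \<gamma> * t - a) \<partial>M) \<longlonglongrightarrow> prob ?A"
    using A by (auto elim: Lim_transform_eventually)
  then have "prob ?A = (\<integral>\<omega>. reflected_payoff \<gamma> (B t \<omega> + \<gamma> * t - a) \<partial>M)"
    by (simp add: LIMSEQ_const_iff)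
  also have "\<dots> = (\<integral>\<omega>. reflected_payoff \<gamma> (- a + \<gamma> * t + (B t \<omega> - B 0 \<omega>)) \<partial>M)"
  proof (rule integral_cong_AE)
    show "AE \<omega> in M. reflected_payoff \<gamma> (B t \<omega> + \<gamma> * t - a) =
        reflected_payoff \<gamma> (- a + \<gamma> * t + (B t \<omega> - B 0 \<omega>))"
      using start by eventually_elim (simp add: algebra_simps)
  qed (use measurable[of 0] in measurable)
  also have "\<dots> = reflected_value \<gamma> t (- a)"
    using t expectation_increment[of 0 t "\<lambda>y. reflected_payoff \<gamma> (- a + \<gamma> * t + y)"]
    by (simp add: reflected_value_def)
  finally show "prob ?A = reflected_value \<gamma> t (- a)" .
qed

end

section \<open>The first exit time and the running maximum\<close>

text \<open>
  If the path exceeds \<open>\<delta> x\<close> on \<open>[0, t]\<close>, then it does so at a positive time \<open>s' \<le> t\<close> and still exceeds \<open>\<delta> x'\<close> there for some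
  \<open>x' > x\<close>; every \<open>u < x'\<close> then has \<open>G u \<le> s' \<le> t\<close>. Conversely, if the path stays below
  \<open>\<delta> u\<close> on all of \<open>[0, t]\<close>, then by continuity it does so slightly longer, and \<open>G u > t\<close>.
\<close>
lemma first_exit_time_greater_iff:
  assumes cont: "continuous_on {0..} (\<lambda>s. B s \<omega>)" and \<delta>: "0 < \<delta>" and t: "0 < t" and x: "0 \<le> x"
  shows "0 \<le> first_exit_time (IG_subordinator B \<delta> \<gamma>) t \<omega>"
    and "x < first_exit_time (IG_subordinator B \<delta> \<gamma>) t \<omega> \<longleftrightarrow> (\<exists>s\<in>{0..t}. B s \<omega> + \<gamma> * s > \<delta> * x)"
proof -
  define X where "X s = B s \<omega> + \<gamma> * s" for s
  define U where "U = {u. 0 < u \<and> IG_subordinator B \<delta> \<gamma> u \<omega> > ereal t}"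
  have X: "continuous_on {0..} X"
    unfolding X_def by (intro continuous_intros cont)
  have in_U: "u \<in> U" if u: "0 < u" and below: "\<And>s. s \<in> {0..t} \<Longrightarrow> X s < \<delta> * u" for u
  proof -
    obtain d where d: "0 < d" and near: "\<And>s. s \<in> {0..} \<Longrightarrow> \<bar>s - t\<bar> < d \<Longrightarrow> - (\<delta> * u) < - X s"
      using continuous_on_locally_greater[of "{0..}" "\<lambda>s. - X s" t "- (\<delta> * u)"]
        continuous_on_minus[OF X] below[of t] t by auto
    have "ereal (t + d) \<le> IG_subordinator B \<delta> \<gamma> u \<omega>"
      unfolding IG_subordinator_def
    proof (rule Inf_greatest, clarify)
      fix s assume s: "0 < s" "B s \<omega> + \<gamma> * s > \<delta> * u"
      have "\<not> s < t + d"
        using below[of s] near[of s] s by (cases "s \<le> t") (auto simp: X_def)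
      then show "ereal (t + d) \<le> ereal s" by simp
    qed
    moreover have "ereal t < ereal (t + d)" using d by simp
    ultimately have "ereal t < IG_subordinator B \<delta> \<gamma> u \<omega>" by (rule less_le_trans[rotated])
    then show ?thesis using u by (simp add: U_def)
  qed
  have not_in_U: "u \<notin> U" if "s \<in> {0<..t}" "X s > \<delta> * u" for s u
  proof -
    have "IG_subordinator B \<delta> \<gamma> u \<omega> \<le> ereal s"
      unfolding IG_subordinator_def using that by (intro Inf_lower) (auto simp: X_def)
    also have "\<dots> \<le> ereal t" using that by simp
    finally show ?thesis by (auto simp: U_def)
  qed
  have bdd: "bdd_below U" by (auto simp: U_def bdd_below_def intro: less_imp_le)
  have "U \<noteq> {}"
  proof -
    have "compact (X ` {0..t})"
      by (intro compact_continuous_image continuous_on_subset[OF X]) auto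
    then obtain c where c: "\<And>s. s \<in> {0..t} \<Longrightarrow> \<bar>X s\<bar> \<le> c"
      by (meson bounded_real compact_imp_bounded imageI)
    have "0 \<le> c" using c[of 0] t by simp
    have "(c + 1) / \<delta> \<in> U"
      using c \<delta> \<open>0 \<le> c\<close> by (intro in_U) (force simp: abs_le_iff)+
    then show ?thesis by auto
  qed
  show "0 \<le> first_exit_time (IG_subordinator B \<delta> \<gamma>) t \<omega>"
    unfolding first_exit_time_def U_def[symmetric] using \<open>U \<noteq> {}\<close>
    by (rule cInf_greatest) (simp add: U_def)
  show "x < first_exit_time (IG_subordinator B \<delta> \<gamma>) t \<omega> \<longleftrightarrow> (\<exists>s\<in>{0..t}. B s \<omega> + \<gamma> * s > \<delta> * x)"
    unfolding first_exit_time_def U_def[symmetric] X_def[symmetric]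
  proof
    assume less: "x < Inf U"
    show "\<exists>s\<in>{0..t}. X s > \<delta> * x"
    proof (rule ccontr)
      assume no: "\<not> (\<exists>s\<in>{0..t}. X s > \<delta> * x)"
      define u where "u = (x + Inf U) / 2"
      have u: "x < u" "u < Inf U" using less by (auto simp: u_def)
      have "\<delta> * x < \<delta> * u" using u \<delta> by simp
      then have "u \<in> U" using no u x by (intro in_U) (auto simp: not_less intro: le_less_trans)
      then show False using cInf_lower[OF _ bdd] u by fastforce
    qed
  next
    assume "\<exists>s\<in>{0..t}. X s > \<delta> * x"
    then obtain s where s: "s \<in> {0..t}" "\<delta> * x < X s" by auto
    \<comment> \<open>The infimum defining \<open>G\<close> ranges over positive times only, so \<open>s = 0\<close> has to be moved.\<close>
    obtain s' where s': "s' \<in> {0<..t}" "\<delta> * x < X s'"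
    proof (cases "s = 0")
      case True
      obtain d where d: "0 < d" and near: "\<And>u. u \<in> {0..} \<Longrightarrow> \<bar>u - 0\<bar> < d \<Longrightarrow> \<delta> * x < X u"
        using continuous_on_locally_greater[OF X, of 0 "\<delta> * x"] s True by auto
      show ?thesis using that[of "min t (d / 2)"] near[of "min t (d / 2)"] d t by auto
    qed (use s that[of s] in auto)
    have "x < X s' / \<delta>" using s' \<delta> by (simp add: pos_less_divide_eq mult.commute)
    then obtain x' where x': "x < x'" "x' < X s' / \<delta>" using dense by blast
    then have "\<delta> * x' < X s'" using \<delta> by (simp add: pos_less_divide_eq mult.commute)
    have "x' \<le> u" if "u \<in> U" for u
    proof (rule ccontr)
      assume "\<not> x' \<le> u"
      then have "\<delta> * u < \<delta> * x'" using \<delta> by simp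
      then show False using not_in_U[OF s'(1), of u] that \<open>\<delta> * x' < X s'\<close> by auto
    qed
    then have "x' \<le> Inf U" using \<open>U \<noteq> {}\<close> by (intro cInf_greatest)
    then show "x < Inf U" using x' by simp
  qed
qed

lemma (in standard_brownian_motion) first_exit_time_distribution:
  assumes \<delta>: "0 < \<delta>" and \<gamma>: "0 \<le> \<gamma>" and t: "0 < t"
  defines "H \<equiv> first_exit_time (IG_subordinator B \<delta> \<gamma>) t"
  shows "H \<in> borel_measurable M"
    and "\<And>x. x < 0 \<Longrightarrow> prob {\<omega> \<in> space M. H \<omega> \<le> x} = 0"
    and "\<And>x. 0 \<le> x \<Longrightarrow> prob {\<omega> \<in> space M. H \<omega> \<le> x} = 1 - reflected_value \<gamma> t (- (\<delta> * x))"
proof -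
  have iff: "x < H \<omega> \<longleftrightarrow> (\<exists>s\<in>{0..t}. B s \<omega> + \<gamma> * s > \<delta> * x)" if "0 \<le> x" "\<omega> \<in> space M" for x \<omega>
    unfolding H_def by (rule first_exit_time_greater_iff(2)[where B=B and \<omega>=\<omega>, OF continuous_paths[OF that(2)] \<delta> t that(1)])
  have nonneg: "0 \<le> H \<omega>" if "\<omega> \<in> space M" for \<omega>
    unfolding H_def by (rule first_exit_time_greater_iff(1)[where B=B and \<omega>=\<omega>, OF continuous_paths[OF that] \<delta> t order_refl])
  have tail: "{\<omega> \<in> space M. x < H \<omega>} = {\<omega> \<in> space M. \<exists>s\<in>{0..t}. B s \<omega> + \<gamma> * s > \<delta> * x}"
    if "0 \<le> x" for x
    using iff[OF that] by auto
  have a: "0 \<le> \<delta> * x" if "0 \<le> x" for x using that \<delta> by simp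
  show [measurable]: "H \<in> borel_measurable M"
  proof (rule borel_measurableI_greater)
    fix x
    show "{\<omega> \<in> space M. x < H \<omega>} \<in> sets M"
    proof (cases "0 \<le> x")
      case True
      then show ?thesis unfolding tail[OF True] using running_maximum_tail(1)[OF \<gamma> t a] by blast
    next
      case False
      then have "{\<omega> \<in> space M. x < H \<omega>} = space M" using nonneg by force
      then show ?thesis by simp
    qed
  qed
  show "prob {\<omega> \<in> space M. H \<omega> \<le> x} = 0" if "x < 0" for x
  proof -
    have empty: "{\<omega> \<in> space M. H \<omega> \<le> x} = {}" using nonneg that by force
    show ?thesis unfolding empty by simp
  qed
  show "prob {\<omega> \<in> space M. H \<omega> \<le> x} = 1 - reflected_value \<gamma> t (- (\<delta> * x))" if x: "0 \<le> x" for x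
  proof -
    have "{\<omega> \<in> space M. H \<omega> \<le> x} = space M - {\<omega> \<in> space M. x < H \<omega>}" by auto
    also have "prob \<dots> = 1 - prob {\<omega> \<in> space M. x < H \<omega>}" by (rule prob_compl) measurable
    finally show ?thesis unfolding tail[OF x] running_maximum_tail(2)[OF \<gamma> t a[OF x]] .
  qed
qed

lemma continuous_on_max_density:
  assumes "0 < t"
  shows "continuous_on A (\<lambda>a. max_density \<gamma> t a)"
  unfolding max_density_def std_normal_density_def using assms by (auto intro!: continuous_intros)

text \<open>
  The density is minus the derivative of a tail probability, which is antitone; the endpoint
  \<open>0\<close> follows by continuity.
\<close>
lemma (in standard_brownian_motion) max_density_nonneg:
  assumes \<gamma>: "0 \<le> \<gamma>" and t: "0 < t" and a: "0 \<le> a"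
  shows "0 \<le> max_density \<gamma> t a"
proof -
  have mono: "mono_on {0..} (\<lambda>a. - reflected_value \<gamma> t (- a))"
  proof (rule mono_onI)
    fix b c :: real assume bc: "b \<in> {0..}" "c \<in> {0..}" "b \<le> c"
    have "prob {\<omega> \<in> space M. \<exists>s\<in>{0..t}. B s \<omega> + \<gamma> * s > c} \<le> prob {\<omega> \<in> space M. \<exists>s\<in>{0..t}. B s \<omega> + \<gamma> * s > b}"
      using bc running_maximum_tail(1)[OF \<gamma> t, of b] by (intro finite_measure_mono) force+
    then show "- reflected_value \<gamma> t (- b) \<le> - reflected_value \<gamma> t (- c)"
      using bc running_maximum_tail(2)[OF \<gamma> t] by simp
  qed
  have pos: "0 \<le> max_density \<gamma> t b" if "b \<in> {0<..}" for b
  proof (rule mono_on_imp_deriv_nonneg[OF mono])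
    show "((\<lambda>a. - reflected_value \<gamma> t (- a)) has_real_derivative max_density \<gamma> t b) (at b)"
      using DERIV_minus[OF DERIV_reflected_value_minus[OF t, of \<gamma> b]] by simp
    show "b \<in> interior {0..}" using that by simp
  qed
  show ?thesis
    by (rule continuous_ge_on_closure[OF continuous_on_max_density[OF t], of _ "{0<..}"]) (use a pos in auto)
qed

lemma (in standard_brownian_motion) first_exit_time_distributed:
  assumes \<delta>: "0 < \<delta>" and \<gamma>: "0 \<le> \<gamma>" and t: "0 < t"
  defines "H \<equiv> first_exit_time (IG_subordinator B \<delta> \<gamma>) t"
  defines "h \<equiv> \<lambda>x. if 0 < x then \<delta> * max_density \<gamma> t (\<delta> * x) else 0"
  shows "distributed M lborel H (\<lambda>x. ennreal (h x))"
proof -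
  note H = first_exit_time_distribution[OF \<delta> \<gamma> t, folded H_def]
  have h0: "0 \<le> h x" for x
    using max_density_nonneg[OF \<gamma> t] \<delta> by (simp add: h_def)
  define g where "g x = (if 0 \<le> x then 1 - reflected_value \<gamma> t (- (\<delta> * x)) else 0)" for x
  show ?thesis
  proof (rule distributedI_borel_atMost[where g=g])
    have [measurable]: "max_density \<gamma> t \<in> borel_measurable borel"
      by (rule borel_measurable_continuous_onI[OF continuous_on_max_density[OF t]])
    show "h \<in> borel_measurable borel" unfolding h_def by measurable
    show "emeasure M {\<omega> \<in> space M. H \<omega> \<le> x} = ennreal (g x)" for x
      using H(2,3)[of x] by (simp add: emeasure_eq_measure g_def)
    show "(\<integral>\<^sup>+y. ennreal (h y * indicator {..x} y) \<partial>lborel) = ennreal (g x)" for x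
    proof (cases "0 \<le> x")
      case True
      have deriv: "((\<lambda>y. - reflected_value \<gamma> t (- (\<delta> * y))) has_real_derivative
          \<delta> * max_density \<gamma> t (\<delta> * y)) (at y)" for y
      proof -
        have "((\<lambda>y. \<delta> * y) has_real_derivative \<delta>) (at y)" by (auto intro!: derivative_eq_intros)
        from DERIV_minus[OF DERIV_chain2[OF DERIV_reflected_value_minus[OF t] this]]
        show ?thesis by (simp add: mult.commute)
      qed
      have nonneg: "0 \<le> \<delta> * max_density \<gamma> t (\<delta> * y)" if "0 \<le> y" for y
        using max_density_nonneg[OF \<gamma> t, of "\<delta> * y"] that \<delta> by simp
      have "(\<integral>\<^sup>+y. ennreal (h y * indicator {..x} y) \<partial>lborel) =
          (\<integral>\<^sup>+y. ennreal (\<delta> * max_density \<gamma> t (\<delta> * y)) * indicator {0..x} y \<partial>lborel)"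
        by (rule nn_integral_cong_AE)
          (auto intro!: eventually_mono[OF AE_lborel_singleton[of 0]] simp: h_def indicator_def)
      also have "\<dots> = - reflected_value \<gamma> t (- (\<delta> * x)) - (- reflected_value \<gamma> t (- (\<delta> * 0)))"
        using True nonneg deriv by (intro nn_integral_FTC_Icc) auto
      finally show ?thesis using True reflected_value_0[OF t, of \<gamma>] by (simp add: g_def)
    next
      case False
      have "(\<integral>\<^sup>+y. ennreal (h y * indicator {..x} y) \<partial>lborel) = (\<integral>\<^sup>+y. 0 \<partial>(lborel :: real measure))"
        using False by (intro nn_integral_cong) (auto simp: h_def indicator_def)
      then show ?thesis using False by (simp add: g_def)
    qed
  qed (use H(1) h0 in auto)
qed

theorem theorem2p2:
  fixes M :: "'a measure" and B :: "real \<Rightarrow> 'a \<Rightarrow> real"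
    and G :: "real \<Rightarrow> 'a \<Rightarrow> ereal" and H :: "real \<Rightarrow> 'a \<Rightarrow> real"
    and \<delta> \<gamma> t :: real
  assumes "standard_brownian_motion M B"
    and "\<delta> > 0" and "\<gamma> \<ge> 0"
    and "G = IG_subordinator B \<delta> \<gamma>"
    and "H = first_exit_time G"
    and "t > 0"
  shows "\<exists>h :: real \<Rightarrow> real.
    (\<forall>x. 0 \<le> h x) \<and> (\<forall>x\<le>0. h x = 0) \<and>
    distributed M lborel (H t) (\<lambda>x. ennreal (h x)) \<and>
    (\<forall>x>0.
      set_integrable lborel {0<..} (\<lambda>y. exp (- t * y) / (y + \<gamma>\<^sup>2 / 2) *
        (\<gamma> * sin (\<delta> * x * sqrt (2 * y)) + sqrt (2 * y) * cos (\<delta> * x * sqrt (2 * y)))) \<and>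
      h x = \<delta> / pi * exp (\<delta> * \<gamma> * x - \<gamma>\<^sup>2 / 2 * t) *
        (LBINT y:{0<..}. exp (- t * y) / (y + \<gamma>\<^sup>2 / 2) *
          (\<gamma> * sin (\<delta> * x * sqrt (2 * y)) + sqrt (2 * y) * cos (\<delta> * x * sqrt (2 * y)))))"
proof -
  interpret standard_brownian_motion M B by fact
  note pos = \<open>\<delta> > 0\<close> \<open>\<gamma> \<ge> 0\<close> \<open>t > 0\<close>
  define h where "h = (\<lambda>x. if 0 < x then \<delta> * max_density \<gamma> t (\<delta> * x) else 0)"
  show ?thesis
  proof (intro exI[of _ h] conjI allI impI)
    show "0 \<le> h x" for x
      using max_density_nonneg[OF pos(2,3)] pos(1) by (simp add: h_def)
    show "h x = 0" if "x \<le> 0" for x using that by (simp add: h_def)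
    show "distributed M lborel (H t) (\<lambda>x. ennreal (h x))"
      using first_exit_time_distributed[OF pos] assms(4,5) by (simp add: h_def)
  next
    fix x :: real assume x: "0 < x"
    define f where "f y = exp (- t * y) / (y + \<gamma>\<^sup>2 / 2) *
        (\<gamma> * sin (\<delta> * x * sqrt (2 * y)) + sqrt (2 * y) * cos (\<delta> * x * sqrt (2 * y)))" for y
    have [measurable]: "f \<in> borel_measurable borel" unfolding f_def by measurable
    have eq: "w * f (w\<^sup>2 / 2) = w * (exp (- t * w\<^sup>2 / 2) / (w\<^sup>2 / 2 + \<gamma>\<^sup>2 / 2) *
        (\<gamma> * sin (\<delta> * x * w) + w * cos (\<delta> * x * w)))" if "w \<in> {0<..}" for w
      using that by (simp add: f_def)
    note F = frequency_integral[OF pos(2,3), of "\<delta> * x"]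
    have int: "set_integrable lborel {0<..} (\<lambda>w. w * f (w\<^sup>2 / 2))"
      by (rule set_integrable_cong[THEN iffD2, OF refl refl _ F(1)]) (rule eq)
    have "(LBINT y:{0<..}. f y) = (LBINT w:{0<..}. w * f (w\<^sup>2 / 2))"
      by (rule set_integral_half_square_substitution[OF _ int]) measurable
    also have "\<dots> = pi * exp (- \<gamma> * (\<delta> * x) + \<gamma>\<^sup>2 * t / 2) * max_density \<gamma> t (\<delta> * x)"
      unfolding F(2)[symmetric] by (rule set_lebesgue_integral_cong) (use eq in auto)
    finally have I: "(LBINT y:{0<..}. f y) = pi * exp (- \<gamma> * (\<delta> * x) + \<gamma>\<^sup>2 * t / 2) * max_density \<gamma> t (\<delta> * x)" .
    have "exp (\<delta> * \<gamma> * x - \<gamma>\<^sup>2 / 2 * t) * exp (- \<gamma> * (\<delta> * x) + \<gamma>\<^sup>2 * t / 2) = 1"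
      by (simp flip: exp_add)
    then have "h x = \<delta> / pi * exp (\<delta> * \<gamma> * x - \<gamma>\<^sup>2 / 2 * t) * (LBINT y:{0<..}. f y)"
      unfolding I using x by (simp add: h_def)
    then show "h x = \<delta> / pi * exp (\<delta> * \<gamma> * x - \<gamma>\<^sup>2 / 2 * t) *
        (LBINT y:{0<..}. exp (- t * y) / (y + \<gamma>\<^sup>2 / 2) *
          (\<gamma> * sin (\<delta> * x * sqrt (2 * y)) + sqrt (2 * y) * cos (\<delta> * x * sqrt (2 * y))))"
      unfolding f_def .
    show "set_integrable lborel {0<..} (\<lambda>y. exp (- t * y) / (y + \<gamma>\<^sup>2 / 2) *
        (\<gamma> * sin (\<delta> * x * sqrt (2 * y)) + sqrt (2 * y) * cos (\<delta> * x * sqrt (2 * y))))"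
      using set_integral_half_square_substitution(1)[OF _ int] unfolding f_def by measurable
  qed
qed

end
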